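(* Let $\Lambda\in\mathbb{R}$ denote the $\mathbb{P}_o$-almost sure limit $\Lambda=\lim_{k\to\infty}\mathbf{e}_k/k$ of the normalized exit times (this limit exists and is a constant). Then $$\frac{\ell(Z_n)}{n}\ \xrightarrow{n\to\infty}\ \ell=\frac{1}{\Lambda}\qquad \mathbb{P}_o\text{-almost surely}.$$
   Context: Let $\mathbb{N}=\{1,2,\dots\}$ and $\mathbb{N}_0=\mathbb{N}\cup\{0\}$. Let $\mathcal{I}=\{1,\dots,r\}$ with $r\ge 2$. For each $i\in\mathcal{I}$ let $V_i$ be a finite or countable set (the $V_i$ pairwise disjoint) with a chosen root $o_i\in V_i$ and a transition matrix $P_i=(p_i(x,y))_{x,y\in V_i}$ with $n$-step probabilities $p_i^{(n)}(x,y)$. Assume $p_i(x,x)=0$ for all $x\in V_i$, and that for every $x\in V_i$ there is $n\in\mathbb{N}$ with $p_i^{(n)}(o_i,x)>0$. Put $V_i^\times=V_i\setminus\{o_i\}$. The free product $V=V_1\ast\dots\ast V_r$ is the set of finite words $x_1\dots x_m$ with letters (blocks) in $\bigcup_i V_i^\times$ such that no two consecutive letters come from the same $V_i$, including the empty word $o$. Each $V_i$ is regarded as a subset of $V$ by identifying $o_i$ with $o$. For $x=x_1\dots x_m\neq o$ the type is $\tau(x)=i$ if $x_m\in V_i$, and the block length is $\ell(x)=m$; $\tau(o)=0$, $\ell(o)=0$. For $k\in\mathbb{N}$ the truncation is $x^{(k)}=x_1\dots x_{\min\{k,m\}}$ (and $o^{(k)}=o$). Fix $\alpha_1,\dots,\alpha_r>0$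 with $\sum_i\alpha_i=1$. Let $\bar P_i$ be the lift of $P_i$ to $V$: $\bar p_i(zv,zw)=p_i(v,w)$ if $v,w\in V_i$ and $z\in V$ is $o$ or has last letter not in $V_i$; $\bar p_i(x,y)=0$ otherwise. The random walk $(Z_n)_{n\in\mathbb{N}_0}$ on $V$ has transition matrix $P=\sum_i\alpha_i\bar P_i$, with $n$-step probabilities $p^{(n)}(x,y)$, and $\mathbb{P}_x$ denotes its law started at $x$. Standing assumption: the power series $G(o,o|z)=\sum_{n\ge0}p^{(n)}(o,o)z^n$ has radius of convergence greater than $1$. The exit time with respect to block length $k\in\mathbb{N}$ is $\mathbf{e}_k=\min\{m\in\mathbb{N}: Z_n^{(k)}\text{ is constant for all } n\ge m\}$ (it is $\mathbb{P}_o$-almost surely finite). *)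

theory Defs
  imports "HOL-Probability.Probability"
begin

section \<open>Transition matrices and Markov chains on a countable state space\<close>

definition transition_matrix :: "'s set \<Rightarrow> ('s \<Rightarrow> 's \<Rightarrow> real) \<Rightarrow> bool" where
  "transition_matrix S P \<longleftrightarrow>
     (\<forall>x\<in>S. (\<forall>y\<in>S. 0 \<le> P x y) \<and> (P x has_sum 1) S)"

primrec n_step :: "'s set \<Rightarrow> ('s \<Rightarrow> 's \<Rightarrow> real) \<Rightarrow> nat \<Rightarrow> 's \<Rightarrow> 's \<Rightarrow> real" where
  "n_step S P 0 x y = (if x = y then 1 else 0)"
| "n_step S P (Suc n) x y = (\<Sum>\<^sub>\<infinity>w\<in>S. P x w * n_step S P n w y)"

text \<open>
  Under the probability measure \<open>M\<close>, the process \<open>Z\<close> is a Markov chain with state space \<open>S\<close>,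
  transition matrix \<open>P\<close> and deterministic initial state \<open>x\<close>, expressed by its
  finite-dimensional distributions.
\<close>

definition markov_chain ::
  "'w measure \<Rightarrow> 's set \<Rightarrow> ('s \<Rightarrow> 's \<Rightarrow> real) \<Rightarrow> 's \<Rightarrow> (nat \<Rightarrow> 'w \<Rightarrow> 's) \<Rightarrow> bool" where
  "markov_chain M S P x Z \<longleftrightarrow>
     prob_space M \<and>
     (\<forall>n. Z n \<in> measurable M (count_space S)) \<and>
     (\<forall>n s. (\<forall>j\<le>n. s j \<in> S) \<longrightarrow>
        measure M {\<omega> \<in> space M. \<forall>j\<le>n. Z j \<omega> = s j} =
          (if s 0 = x then \<Prod>j<n. P (s j) (s (Suc j)) else 0))"


section \<open>Free products\<close>

text \<open>
  The factors are \<open>V 1, \<dots>, V r\<close> with roots \<open>rt i \<in> V i\<close>.  Words are lists of non-root letters,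
  so the empty word \<open>o\<close> is \<open>[]\<close>, the block length is \<^const>\<open>length\<close>, and the truncation of
  \<open>x\<close> to its first \<open>k\<close> blocks is \<open>take k x\<close>.
\<close>

definition free_product :: "nat \<Rightarrow> (nat \<Rightarrow> 'a set) \<Rightarrow> (nat \<Rightarrow> 'a) \<Rightarrow> 'a list set" where
  "free_product r V rt =
     {x. set x \<subseteq> (\<Union>i\<in>{1..r}. V i - {rt i}) \<and>
         successively (\<lambda>a b. \<not> (\<exists>i\<in>{1..r}. a \<in> V i \<and> b \<in> V i)) x}"

text \<open>The word \<open>z v\<close> for \<open>v \<in> V i\<close>, where the root of \<open>V i\<close> is identified with the empty word.\<close>

definition app_letter :: "(nat \<Rightarrow> 'a) \<Rightarrow> nat \<Rightarrow> 'a list \<Rightarrow> 'a \<Rightarrow> 'a list" where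
  "app_letter rt i z v = (if v = rt i then z else z @ [v])"

text \<open>
  Every word \<open>x\<close> can be written in exactly one way as \<open>z v\<close> with \<open>v \<in> V i\<close> and \<open>z\<close> either empty or
  with last letter outside \<open>V i\<close>; \<open>stem\<close> is this \<open>z\<close> and \<open>letter\<close> is this \<open>v\<close>.
\<close>

definition stem :: "(nat \<Rightarrow> 'a set) \<Rightarrow> nat \<Rightarrow> 'a list \<Rightarrow> 'a list" where
  "stem V i x = (if x \<noteq> [] \<and> last x \<in> V i then butlast x else x)"

definition letter :: "(nat \<Rightarrow> 'a set) \<Rightarrow> (nat \<Rightarrow> 'a) \<Rightarrow> nat \<Rightarrow> 'a list \<Rightarrow> 'a" where
  "letter V rt i x = (if x \<noteq> [] \<and> last x \<in> V i then last x else rt i)"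

text \<open>
  The lift of \<open>p i\<close> to the free product.  The lemmas \<open>lift_matrix_app_letter\<close> and
  \<open>lift_matrix_eq_0\<close> below are its usual description: the entry at \<open>(z v, z w)\<close> is \<open>p i v w\<close>,
  and all entries not of this form vanish.
\<close>

definition lift_matrix ::
  "nat \<Rightarrow> (nat \<Rightarrow> 'a set) \<Rightarrow> (nat \<Rightarrow> 'a) \<Rightarrow> (nat \<Rightarrow> 'a \<Rightarrow> 'a \<Rightarrow> real) \<Rightarrow>
   nat \<Rightarrow> 'a list \<Rightarrow> 'a list \<Rightarrow> real" where
  "lift_matrix r V rt p i x y =
     (if x \<in> free_product r V rt \<and> y \<in> free_product r V rt \<and> stem V i x = stem V i y
      then p i (letter V rt i x) (letter V rt i y) else 0)"

definition walk_matrix ::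
  "nat \<Rightarrow> (nat \<Rightarrow> 'a set) \<Rightarrow> (nat \<Rightarrow> 'a) \<Rightarrow> (nat \<Rightarrow> 'a \<Rightarrow> 'a \<Rightarrow> real) \<Rightarrow>
   (nat \<Rightarrow> real) \<Rightarrow> 'a list \<Rightarrow> 'a list \<Rightarrow> real" where
  "walk_matrix r V rt p \<alpha> x y = (\<Sum>i=1..r. \<alpha> i * lift_matrix r V rt p i x y)"

lemma app_letter_in_free_product:
  assumes "disjoint_family_on V {1..r}" "i \<in> {1..r}" "z \<in> free_product r V rt"
    and "z = [] \<or> last z \<notin> V i" "v \<in> V i"
  shows "app_letter rt i z v \<in> free_product r V rt"
proof -
  have "\<not> (\<exists>j\<in>{1..r}. last z \<in> V j \<and> v \<in> V j)" if "z \<noteq> []"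
  proof
    assume "\<exists>j\<in>{1..r}. last z \<in> V j \<and> v \<in> V j"
    then obtain j where j: "j \<in> {1..r}" "last z \<in> V j" "v \<in> V j" by blast
    with assms(1,2,5) have "j = i"
      by (metis disjoint_iff disjoint_family_on_def)
    with j(2) assms(4) that show False by simp
  qed
  then show ?thesis
    using assms by (auto simp: app_letter_def free_product_def successively_append_iff)
qed

lemma stem_app_letter:
  assumes "z = [] \<or> last z \<notin> V i" "v \<in> V i"
  shows "stem V i (app_letter rt i z v) = z" "letter V rt i (app_letter rt i z v) = v"
  using assms by (auto simp: app_letter_def stem_def letter_def)

lemma lift_matrix_app_letter:
  assumes "disjoint_family_on V {1..r}" "i \<in> {1..r}" "z \<in> free_product r V rt"
    and "z = [] \<or> last z \<notin> V i" "v \<in> V i" "w \<in> V i"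
  shows "lift_matrix r V rt p i (app_letter rt i z v) (app_letter rt i z w) = p i v w"
  using assms by (simp add: lift_matrix_def app_letter_in_free_product stem_app_letter)

lemma app_letter_stem:
  assumes "disjoint_family_on V {1..r}" "i \<in> {1..r}" "rt i \<in> V i" "x \<in> free_product r V rt"
  shows "app_letter rt i (stem V i x) (letter V rt i x) = x"
    and "stem V i x \<in> free_product r V rt"
    and "stem V i x = [] \<or> last (stem V i x) \<notin> V i"
    and "letter V rt i x \<in> V i"
proof -
  have *: "(app_letter rt i (stem V i x) (letter V rt i x) = x \<and>
        stem V i x \<in> free_product r V rt \<and>
        (stem V i x = [] \<or> last (stem V i x) \<notin> V i) \<and> letter V rt i x \<in> V i)"
  proof (cases "x \<noteq> [] \<and> last x \<in> V i")
    case False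
    then show ?thesis
      using assms by (auto simp: app_letter_def stem_def letter_def)
  next
    case True
    then obtain z a where x: "x = z @ [a]" and a: "a \<in> V i"
      by (metis append_butlast_last_id)
    from assms(4) x obtain j where "j \<in> {1..r}" "a \<in> V j" "a \<noteq> rt j"
      by (auto simp: free_product_def)
    with a assms(1,2) have "a \<noteq> rt i"
      by (metis disjoint_iff disjoint_family_on_def)
    with assms x a show ?thesis
      by (auto simp: app_letter_def stem_def letter_def free_product_def successively_append_iff)
  qed
  then show "app_letter rt i (stem V i x) (letter V rt i x) = x"
    "stem V i x \<in> free_product r V rt"
    "stem V i x = [] \<or> last (stem V i x) \<notin> V i"
    "letter V rt i x \<in> V i"
    by blast+
qed

lemma lift_matrix_eq_0:
  assumes "disjoint_family_on V {1..r}" "i \<in> {1..r}" "rt i \<in> V i"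
    and "\<not> (\<exists>z v w. z \<in> free_product r V rt \<and> (z = [] \<or> last z \<notin> V i) \<and> v \<in> V i \<and> w \<in> V i \<and>
           x = app_letter rt i z v \<and> y = app_letter rt i z w)"
  shows "lift_matrix r V rt p i x y = 0"
proof (rule ccontr)
  assume "lift_matrix r V rt p i x y \<noteq> 0"
  then have xy: "x \<in> free_product r V rt" "y \<in> free_product r V rt" "stem V i x = stem V i y"
    by (auto simp: lift_matrix_def split: if_splits)
  show False
    using assms(4) app_letter_stem[OF assms(1-3) xy(1)] app_letter_stem[OF assms(1-3) xy(2)] xy(3)
    by metis
qed


section \<open>Exit times\<close>

text \<open>
  The first time \<open>m \<ge> 1\<close> from which on the first \<open>k\<close> blocks no longer change.  If there is no such
  time, the value is an unspecified natural number; for the random walks considered here this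
  happens with probability zero.
\<close>

definition exit_time :: "(nat \<Rightarrow> 'w \<Rightarrow> 'a list) \<Rightarrow> nat \<Rightarrow> 'w \<Rightarrow> nat" where
  "exit_time Z k \<omega> = (LEAST m. 1 \<le> m \<and> (\<forall>n\<ge>m. take k (Z n \<omega>) = take k (Z m \<omega>)))"

end

theory Submission
  imports Defs
begin

text \<open>
  The walk is studied through its taboo probabilities: let \<open>q n x\<close> be the probability that the walk
  started at the empty word is at \<open>x\<close> at time \<open>n\<close> and has not come back to the empty word.
  Splitting a path at its last visit to the empty word gives
  \<open>p\<^sup>n(o, x) = (\<Sum>m\<le>n. p\<^sup>m(o, o) q (n - m) x)\<close>, and splitting it at its last visit to the one-letter
  word \<open>s\<close> gives \<open>q n (s w) = (\<Sum>m\<le>n. q m s * q (n - m) w)\<close>, because the walk above \<open>s\<close> is a copy of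
  the whole walk (lemmas \<open>occ_last_visit\<close> and \<open>taboo_Cons\<close>).  On the level of generating functions
  in a variable \<open>z\<close>, the weight of a word is therefore the product of the weights of its letters,
  multiplied by the Green function \<open>G(z)\<close>.

  Let \<open>L j z\<close> be the total weight of the letters of the \<open>j\<close>-th factor.  As the only constraint on a
  word is that neighbouring letters come from different factors, summing the weights times
  \<open>b ^ length x\<close> over all words is a linear problem in \<open>r\<close> unknowns with the solution
  \<open>1 / (1 - \<Phi> z b)\<close>, where \<open>\<Phi> z b = (\<Sum>j. b L j z / (1 + b L j z))\<close>.  Hence, if \<open>G(z)\<close> and the
  \<open>L j z\<close> are finite and \<open>\<Phi> z b < 1\<close>, the series \<open>\<Sum>n. z ^ n * E (b ^ length (Z n))\<close> converges.
  Then \<open>z ^ n * b ^ length (Z n)\<close> tends to \<open>0\<close> almost surely; for \<open>z = exp s\<close> and \<open>b = exp (- s c)\<close>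
  this says that \<open>s * (n - c * length (Z n))\<close> is negative from some time on.

  The critical point is \<open>\<Phi> 1 1 = 1\<close>.  Total mass \<open>\<Sum>n. z ^ n < \<infinity>\<close> forces \<open>\<Phi> z 1 < 1\<close> for \<open>z < 1\<close>, and
  divergence of this series at \<open>z = 1\<close> together with \<open>G(1) < \<infinity>\<close> forces \<open>\<Phi> 1 1 \<ge> 1\<close>.  The derivative
  of \<open>s \<mapsto> \<Phi> (exp s) (exp (- s c))\<close> at \<open>0\<close> is \<open>N - c M\<close> with \<open>N, M > 0\<close>.  With \<open>\<Lambda> = N / M\<close>, values of
  \<open>c\<close> above \<open>\<Lambda>\<close> admit a small \<open>s > 0\<close>, and values of \<open>c\<close> below \<open>\<Lambda>\<close> a small \<open>s < 0\<close>, such that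
  \<open>\<Phi> (exp s) (exp (- s c)) < 1\<close>.  So \<open>n / length (Z n)\<close> converges to \<open>\<Lambda>\<close> almost surely.

  Differentiating at \<open>1\<close> requires the \<open>L j\<close> to be finite slightly beyond \<open>1\<close>
  (\<open>letter_gf_finite_beyond_1\<close>), although a factor may be infinite.  Here the radius of convergence
  of \<open>G\<close> enters.  A mass balance over the letters of one factor bounds \<open>L j z\<close> as long as
  \<open>z \<alpha>\<^sub>j + B\<^sub>j(z) < 1\<close>, where \<open>B\<^sub>j\<close> generates the first returns to the empty word through the other
  factors.  At \<open>z = 1\<close> this inequality follows from transience, and it persists nearby since
  \<open>B\<^sub>j\<close> is a power series that converges beyond \<open>1\<close>.

  Finally, at the exit time \<open>e k\<close> the walk has exactly \<open>k\<close> blocks, so \<open>k / e k\<close> is a value of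
  \<open>length (Z n) / n\<close> at the time \<open>n = e k \<ge> k\<close>, and both limits are the same statement.
\<close>

section \<open>Sums over countable sets and power series in the extended half-line\<close>

lemma nn_integral_count_space_insert_UN:
  fixes f :: "'a \<Rightarrow> ennreal"
  assumes "finite I" "disjoint_family_on B I" "a \<notin> (\<Union>i\<in>I. B i)"
  shows "(\<integral>\<^sup>+x. f x \<partial>count_space ({a} \<union> (\<Union>i\<in>I. B i))) =
    f a + (\<Sum>i\<in>I. \<integral>\<^sup>+x. f x \<partial>count_space (B i))"
proof -
  have "(\<integral>\<^sup>+x. f x \<partial>count_space ({a} \<union> (\<Union>i\<in>I. B i))) =
      (\<integral>\<^sup>+x. f x * indicator ({a} \<union> (\<Union>i\<in>I. B i)) x \<partial>count_space UNIV)"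
    by (rule nn_integral_count_space_indicator) simp
  also have "\<dots> = (\<integral>\<^sup>+x. f x * indicator {a} x + (\<Sum>i\<in>I. f x * indicator (B i) x) \<partial>count_space UNIV)"
  proof (rule nn_integral_cong)
    fix x
    have "(indicator ({a} \<union> (\<Union>i\<in>I. B i)) x :: ennreal) = indicator {a} x + indicator (\<Union>i\<in>I. B i) x"
      using assms(3) by (auto simp: indicator_def)
    also have "indicator (\<Union>i\<in>I. B i) x = (\<Sum>i\<in>I. indicator (B i) x :: ennreal)"
      using assms by (intro indicator_UN_disjoint)
    finally show "f x * indicator ({a} \<union> (\<Union>i\<in>I. B i)) x =
        f x * indicator {a} x + (\<Sum>i\<in>I. f x * indicator (B i) x)"
      by (simp add: distrib_left sum_distrib_left)
  qed
  also have "\<dots> = (\<integral>\<^sup>+x. f x * indicator {a} x \<partial>count_space UNIV) +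
      (\<Sum>i\<in>I. \<integral>\<^sup>+x. f x * indicator (B i) x \<partial>count_space UNIV)"
    by (simp add: nn_integral_add nn_integral_sum)
  also have "(\<integral>\<^sup>+x. f x * indicator {a} x \<partial>count_space UNIV) = f a"
    by simp
  also have "(\<Sum>i\<in>I. \<integral>\<^sup>+x. f x * indicator (B i) x \<partial>count_space UNIV) =
      (\<Sum>i\<in>I. \<integral>\<^sup>+x. f x \<partial>count_space (B i))"
    by (intro sum.cong nn_integral_count_space_indicator[symmetric]) auto
  finally show ?thesis .
qed

lemma nn_integral_count_space_times:
  fixes f :: "'a \<times> 'b \<Rightarrow> ennreal"
  assumes "countable A" "countable B"
  shows "(\<integral>\<^sup>+z. f z \<partial>count_space (A \<times> B)) =
    (\<integral>\<^sup>+x. \<integral>\<^sup>+y. f (x, y) \<partial>count_space B \<partial>count_space A)"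
proof -
  interpret B: sigma_finite_measure "count_space B"
    by (rule sigma_finite_measure_count_space_countable) fact
  show ?thesis
    by (subst B.nn_integral_fst) (simp_all add: pair_measure_countable assms)
qed

lemma suminf_shift_ennreal:
  fixes f :: "nat \<Rightarrow> ennreal"
  shows "(\<Sum>n. if m \<le> n then f n else 0) = (\<Sum>k. f (m + k))"
proof -
  have "(\<Sum>n. if m \<le> n then f n else 0) =
      (\<integral>\<^sup>+n. (if m \<le> n then f n else 0) \<partial>count_space UNIV)"
    by (rule nn_integral_count_space_nat[symmetric])
  also have "\<dots> = (\<integral>\<^sup>+n. (if m \<le> n then f n else 0) \<partial>count_space {m..})"
    by (rule nn_integral_count_space_eq) auto
  also have "\<dots> = (\<integral>\<^sup>+k. (if m \<le> m + k then f (m + k) else 0) \<partial>count_space UNIV)"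
  proof (rule nn_integral_bij_count_space[symmetric])
    have "(+) m ` UNIV = {m..}" by (auto simp: image_def intro: le_add_diff_inverse[symmetric])
    then show "bij_betw ((+) m) UNIV {m..}" by (simp add: bij_betw_def)
  qed
  finally show ?thesis by (simp add: nn_integral_count_space_nat)
qed

text \<open>
  Coefficients and argument live in \<open>[0, \<infinity>]\<close>, so identities between generating functions hold
  without convergence conditions; finiteness is a separate question.
\<close>

definition gf :: "(nat \<Rightarrow> ennreal) \<Rightarrow> ennreal \<Rightarrow> ennreal" where
  "gf a z = (\<Sum>n. a n * z ^ n)"

lemma gf_convolution:
  "gf (\<lambda>n. \<Sum>m\<le>n. a m * b (n - m)) z = gf a z * gf b z"
proof -
  have "gf (\<lambda>n. \<Sum>m\<le>n. a m * b (n - m)) z =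
      (\<Sum>n. \<Sum>m. if m \<le> n then a m * b (n - m) * z ^ n else 0)"
    unfolding gf_def
  proof (intro arg_cong[where f = suminf] ext)
    fix n
    have "(\<Sum>m. if m \<le> n then a m * b (n - m) * z ^ n else 0) =
        (\<Sum>m\<le>n. if m \<le> n then a m * b (n - m) * z ^ n else 0)"
      by (rule suminf_finite) auto
    then show "(\<Sum>m\<le>n. a m * b (n - m)) * z ^ n =
        (\<Sum>m. if m \<le> n then a m * b (n - m) * z ^ n else 0)"
      by (simp add: sum_distrib_right)
  qed
  also have "\<dots> = (\<Sum>m. \<Sum>n. if m \<le> n then a m * b (n - m) * z ^ n else 0)"
    unfolding nn_integral_count_space_nat[symmetric]
    by (rule nn_integral_count_space_nn_integral) auto
  also have "\<dots> = (\<Sum>m. \<Sum>k. (a m * z ^ m) * (b k * z ^ k))"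
    by (simp add: suminf_shift_ennreal power_add ac_simps del: ennreal_suminf_cmult ennreal_suminf_multc)
  also have "\<dots> = gf a z * gf b z"
    by (simp add: gf_def)
  finally show ?thesis .
qed

lemma gf_nn_integral:
  assumes "\<And>n. f n \<in> borel_measurable M"
  shows "gf (\<lambda>n. \<integral>\<^sup>+x. f n x \<partial>M) z = (\<integral>\<^sup>+x. gf (\<lambda>n. f n x) z \<partial>M)"
  unfolding gf_def using assms by (simp add: nn_integral_suminf nn_integral_multc)

lemma gf_Suc: "gf a z = a 0 + z * gf (\<lambda>n. a (Suc n)) z"
proof -
  have "gf a z = (\<Sum>n. a (Suc n) * z ^ Suc n) + a 0"
    unfolding gf_def using suminf_offset[of "\<lambda>n. a n * z ^ n" 1] by simp
  also have "(\<Sum>n. a (Suc n) * z ^ Suc n) = (\<Sum>n. z * (a (Suc n) * z ^ n))"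
    by (simp add: mult_ac del: ennreal_suminf_cmult ennreal_suminf_multc)
  also have "\<dots> = z * gf (\<lambda>n. a (Suc n)) z"
    by (simp add: gf_def)
  finally show ?thesis by (simp add: add.commute)
qed

lemma gf_add: "gf (\<lambda>n. a n + b n) z = gf a z + gf b z"
  unfolding gf_def by (simp add: distrib_right suminf_add[symmetric])

lemma gf_sum: "gf (\<lambda>n. \<Sum>i\<in>I. a i n) z = (\<Sum>i\<in>I. gf (a i) z)"
  unfolding gf_def by (simp add: sum_distrib_right suminf_sum)

lemma gf_cmult: "gf (\<lambda>n. c * a n) z = c * gf a z"
  unfolding gf_def by (simp add: mult.assoc)

lemma gf_mono: "(\<And>n. a n \<le> b n) \<Longrightarrow> z \<le> z' \<Longrightarrow> gf a z \<le> gf b z'"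
  unfolding gf_def by (intro suminf_le mult_mono power_mono) auto

lemma nn_integral_count_space_has_sum:
  fixes f :: "'a \<Rightarrow> real"
  assumes "(f has_sum c) A" "\<And>x. x \<in> A \<Longrightarrow> 0 \<le> f x"
  shows "(\<integral>\<^sup>+x. f x \<partial>count_space A) = c"
proof -
  have *: "Infinite_Set_Sum.abs_summable_on f A"
    using assms(1) has_sum_imp_summable summable_on_iff_abs_summable_on_real abs_summable_equivalent by blast
  have "(\<integral>\<^sup>+x. f x \<partial>count_space A) = infsetsum f A"
    by (rule nn_integral_conv_infsetsum) (use * assms in auto)
  also have "infsetsum f A = c"
    using infsetsum_infsum[OF *] infsumI[OF assms(1)] by simp
  finally show ?thesis .
qed

text \<open>
  Below a point of finiteness the series is an ordinary real power series.
\<close>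

lemma gf_real:
  fixes a :: "nat \<Rightarrow> ennreal" and z z1 :: real
  assumes fin: "gf a z1 \<noteq> \<top>" and z: "0 \<le> z" "z \<le> z1" "0 < z1"
  shows "summable (\<lambda>n. enn2real (a n) * z ^ n)"
    and "gf a z = ennreal (\<Sum>n. enn2real (a n) * z ^ n)"
proof -
  have a: "a n \<noteq> \<top>" for n
  proof
    assume "a n = \<top>"
    then have "a n * ennreal z1 ^ n = \<top>"
      using z by (simp add: ennreal_top_mult ennreal_power)
    moreover have "a n * ennreal z1 ^ n < \<top>"
      using ennreal_suminf_lessD[of "\<lambda>n. a n * ennreal z1 ^ n" \<top>] fin by (simp add: gf_def less_top)
    ultimately show False by simp
  qed
  then have eq: "a n * ennreal z ^ n = ennreal (enn2real (a n) * z ^ n)" for n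
    using z by (simp add: ennreal_mult ennreal_power less_top)
  have "gf a z \<le> gf a z1" using z by (intro gf_mono) auto
  with fin have fin': "(\<Sum>n. ennreal (enn2real (a n) * z ^ n)) \<noteq> \<top>"
    unfolding gf_def eq by (auto simp: top_unique)
  then show "summable (\<lambda>n. enn2real (a n) * z ^ n)"
    using z by (intro summable_suminf_not_top) auto
  show "gf a z = ennreal (\<Sum>n. enn2real (a n) * z ^ n)"
    unfolding gf_def eq using fin' z by (intro suminf_ennreal) auto
qed

text \<open>
  The lower bound on the derivative is the contribution of the linear term of the series.  For the
  letter weights it is positive, which makes the limit of the normalised exit times positive.
\<close>

lemma gf_has_derivative:
  fixes a :: "nat \<Rightarrow> ennreal" and z z1 :: real
  assumes fin: "gf a z1 \<noteq> \<top>" and z: "0 < z" "z < z1"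
  obtains d where "enn2real (a 1) \<le> d"
    "((\<lambda>x. enn2real (gf a (ennreal x))) has_real_derivative d) (at z)"
proof -
  define c where "c n = enn2real (a n)" for n
  have summ: "summable (\<lambda>n. c n * z1 ^ n)"
    unfolding c_def using gf_real(1)[OF fin, of z1] z by simp
  have D: "((\<lambda>x. \<Sum>n. c n * x ^ n) has_real_derivative (\<Sum>n. diffs c n * z ^ n)) (at z)"
    by (rule termdiffs_strong[OF summ]) (use z in auto)
  have "((\<lambda>x. enn2real (gf a (ennreal x))) has_real_derivative (\<Sum>n. diffs c n * z ^ n)) (at z)"
  proof (rule has_field_derivative_transform_within_open[OF D, of "{0<..<z1}"])
    fix x assume x: "x \<in> {0<..<z1}"
    then have "gf a x = ennreal (\<Sum>n. c n * x ^ n)" "summable (\<lambda>n. c n * x ^ n)"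
      unfolding c_def using gf_real[OF fin, of x] by auto
    moreover have "0 \<le> (\<Sum>n. c n * x ^ n)"
      using x calculation(2) by (intro suminf_nonneg) (auto simp: c_def)
    ultimately show "(\<Sum>n. c n * x ^ n) = enn2real (gf a (ennreal x))" by simp
  qed (use z in auto)
  moreover have "c 1 \<le> (\<Sum>n. diffs c n * z ^ n)"
  proof -
    have "summable (\<lambda>n. diffs c n * z ^ n)"
    proof (rule termdiff_converges[of z z1])
      fix x :: real assume "norm x < z1"
      then show "summable (\<lambda>n. c n * x ^ n)"
        using powser_inside[OF summ, of x] z by simp
    qed (use z in auto)
    then have "sum (\<lambda>n. diffs c n * z ^ n) {0} \<le> (\<Sum>n. diffs c n * z ^ n)"
      using z by (intro sum_le_suminf) (auto simp: diffs_def c_def)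
    then show ?thesis by (simp add: diffs_def)
  qed
  ultimately show thesis using that by (simp add: c_def)
qed

lemma gf_one:
  fixes z :: real
  assumes "0 \<le> z" "z < 1"
  shows "gf (\<lambda>n. 1) z = ennreal (1 / (1 - z))"
proof -
  have "gf (\<lambda>n. 1) z = (\<Sum>n. ennreal (z ^ n))"
    unfolding gf_def using assms by (simp add: ennreal_power)
  also have "\<dots> = ennreal (1 / (1 - z))"
    using assms geometric_sums[of z] by (intro suminf_ennreal_eq) auto
  finally show ?thesis .
qed

lemma gf_one_ge_1: "1 \<le> z \<Longrightarrow> gf (\<lambda>n. 1) z = \<top>"
proof -
  assume z: "1 \<le> z"
  have "gf (\<lambda>n. 1) 1 \<le> gf (\<lambda>n. 1) z" using z by (intro gf_mono) auto
  moreover have "gf (\<lambda>n. 1) 1 = \<top>"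
    by (simp add: gf_def nn_integral_count_space_nat[symmetric] emeasure_count_space_infinite)
  ultimately show ?thesis by (simp add: top_unique)
qed

section \<open>Words and single steps of the walk\<close>

lemma disjoint_family_onE:
  "disjoint_family_on A I \<Longrightarrow> i \<in> I \<Longrightarrow> j \<in> I \<Longrightarrow> x \<in> A i \<Longrightarrow> x \<in> A j \<Longrightarrow> i = j"
  by (auto simp: disjoint_family_on_def)

lemma stem_take:
  shows "length x \<le> Suc (length (stem V i x))" "length (stem V i x) \<le> length x"
    and "k \<le> length (stem V i x) \<Longrightarrow> take k (stem V i x) = take k x"
proof -
  have *: "length x \<le> Suc (length (stem V i x)) \<and> length (stem V i x) \<le> length x \<and>
      (k \<le> length (stem V i x) \<longrightarrow> take k (stem V i x) = take k x)" for k
    by (cases x rule: rev_cases) (auto simp: stem_def)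
  show "length x \<le> Suc (length (stem V i x))" "length (stem V i x) \<le> length x"
    and "k \<le> length (stem V i x) \<Longrightarrow> take k (stem V i x) = take k x"
    using *[of k] by blast+
qed

locale free_product_walk =
  fixes r :: nat and V :: "nat \<Rightarrow> 'a set" and rt :: "nat \<Rightarrow> 'a"
    and p :: "nat \<Rightarrow> 'a \<Rightarrow> 'a \<Rightarrow> real" and \<alpha> :: "nat \<Rightarrow> real"
  assumes r_ge_2: "r \<ge> 2"
    and countable_factor: "\<And>i. i \<in> {1..r} \<Longrightarrow> countable (V i)"
    and disjoint_factors: "disjoint_family_on V {1..r}"
    and root_in_factor: "\<And>i. i \<in> {1..r} \<Longrightarrow> rt i \<in> V i"
    and stochastic: "\<And>i. i \<in> {1..r} \<Longrightarrow> transition_matrix (V i) (p i)"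
    and no_loops: "\<And>i x. i \<in> {1..r} \<Longrightarrow> x \<in> V i \<Longrightarrow> p i x x = 0"
    and \<alpha>_pos: "\<And>i. i \<in> {1..r} \<Longrightarrow> \<alpha> i > 0"
    and \<alpha>_sum: "(\<Sum>i=1..r. \<alpha> i) = 1"
begin

abbreviation W :: "'a list set" where
  "W \<equiv> free_product r V rt"

abbreviation P :: "'a list \<Rightarrow> 'a list \<Rightarrow> real" where
  "P \<equiv> walk_matrix r V rt p \<alpha>"

text \<open>
  A word is empty or starts with a letter of exactly one factor; the sets
  \<open>starting j\<close> and \<open>not_starting j\<close> organise sums over words by this first letter.  Removing the
  first letter of a word in \<open>starting j\<close> leaves an arbitrary word in \<open>not_starting j\<close>.
\<close>

definition letters :: "nat \<Rightarrow> 'a set" where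
  "letters j = V j - {rt j}"

definition not_starting :: "nat \<Rightarrow> 'a list set" where
  "not_starting j = {w \<in> W. w = [] \<or> hd w \<notin> V j}"

definition starting :: "nat \<Rightarrow> 'a list set" where
  "starting j = {w \<in> W. w \<noteq> [] \<and> hd w \<in> V j}"

lemma factor_unique: "i \<in> {1..r} \<Longrightarrow> j \<in> {1..r} \<Longrightarrow> a \<in> V i \<Longrightarrow> a \<in> V j \<Longrightarrow> i = j"
  using disjoint_family_onE[OF disjoint_factors] .

lemma letters_factor: "s \<in> letters j \<Longrightarrow> s \<in> V j"
  by (simp add: letters_def)

lemma Nil_in_W [simp]: "[] \<in> W"
  by (simp add: free_product_def)

lemma Cons_in_W_iff:
  assumes "j \<in> {1..r}" "s \<in> letters j"
  shows "s # w \<in> W \<longleftrightarrow> w \<in> not_starting j"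
proof (cases w)
  case Nil
  with assms show ?thesis by (auto simp: free_product_def not_starting_def letters_def)
next
  case (Cons t u)
  have "(\<exists>i\<in>{1..r}. s \<in> V i \<and> t \<in> V i) \<longleftrightarrow> t \<in> V j"
    using assms factor_unique letters_factor by blast
  with Cons assms show ?thesis
    by (auto simp: free_product_def not_starting_def letters_def)
qed

lemma Cons_in_W_E:
  assumes "s # w \<in> W"
  obtains j where "j \<in> {1..r}" "s \<in> letters j" "w \<in> not_starting j"
proof -
  from assms obtain j where "j \<in> {1..r}" "s \<in> letters j"
    by (auto simp: free_product_def letters_def)
  with assms that Cons_in_W_iff show thesis by blast
qed

lemma not_starting_subset: "not_starting j \<subseteq> W"
  by (auto simp: not_starting_def)

lemma starting_subset: "starting j \<subseteq> W"
  by (auto simp: starting_def)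

lemma starting_eq: "j \<in> {1..r} \<Longrightarrow> starting j = (\<lambda>(s, w). s # w) ` (letters j \<times> not_starting j)"
proof -
  assume j: "j \<in> {1..r}"
  have "x \<in> (\<lambda>(s, w). s # w) ` (letters j \<times> not_starting j)" if "x \<in> starting j" for x
  proof -
    from that obtain s w where x: "x = s # w" "s # w \<in> W" "s \<in> V j"
      by (cases x) (auto simp: starting_def)
    from Cons_in_W_E[OF x(2)] obtain i where "i \<in> {1..r}" "s \<in> letters i" "w \<in> not_starting i"
      by blast
    with x j factor_unique letters_factor show ?thesis by (metis (no_types, lifting) SigmaI case_prod_conv image_eqI)
  qed
  with j show ?thesis
    by (auto simp: starting_def Cons_in_W_iff letters_factor)
qed

lemma W_split: "W = {[]} \<union> (\<Union>j\<in>{1..r}. starting j)"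
proof -
  have "x \<in> {[]} \<union> (\<Union>j\<in>{1..r}. starting j)" if "x \<in> W" for x
    using that by (cases x) (auto simp: starting_def letters_def elim!: Cons_in_W_E)
  then show ?thesis using starting_subset by auto
qed

lemma not_starting_split:
  assumes "j \<in> {1..r}"
  shows "not_starting j = {[]} \<union> (\<Union>i\<in>{1..r} - {j}. starting i)"
proof -
  have "x \<in> {[]} \<union> (\<Union>i\<in>{1..r} - {j}. starting i)" if "x \<in> not_starting j" for x
  proof -
    from that have "x \<in> W" by (simp add: not_starting_def)
    with W_split consider "x = []" | i where "i \<in> {1..r}" "x \<in> starting i" by blast
    then show ?thesis using that by cases (auto simp: not_starting_def starting_def)
  qed
  moreover have "x \<in> not_starting j" if "i \<in> {1..r} - {j}" "x \<in> starting i" for x i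
    using that assms factor_unique[of i j "hd x"] by (auto simp: not_starting_def starting_def)
  moreover have "[] \<in> not_starting j" by (simp add: not_starting_def)
  ultimately show ?thesis by blast
qed

lemma disjoint_starting: "disjoint_family_on starting {1..r}"
  unfolding disjoint_family_on_def starting_def using factor_unique by blast

lemma countable_W: "countable W"
proof -
  have "W \<subseteq> lists (\<Union>i\<in>{1..r}. V i)"
    by (auto simp: free_product_def)
  moreover have "countable (lists (\<Union>i\<in>{1..r}. V i))"
    by (intro countable_lists countable_UN countable_factor) auto
  ultimately show ?thesis using countable_subset by blast
qed

lemma countable_letters: "j \<in> {1..r} \<Longrightarrow> countable (letters j)"
  unfolding letters_def using countable_factor by (auto intro: countable_subset)

lemma p_nonneg: "i \<in> {1..r} \<Longrightarrow> x \<in> V i \<Longrightarrow> y \<in> V i \<Longrightarrow> 0 \<le> p i x y"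
  using stochastic by (auto simp: transition_matrix_def)

lemma lift_nonneg:
  assumes "i \<in> {1..r}"
  shows "0 \<le> lift_matrix r V rt p i x y"
  using app_letter_stem(4)[where rt = rt, OF disjoint_factors assms root_in_factor[OF assms]] assms
  by (auto simp: lift_matrix_def intro!: p_nonneg)

lemma P_nonneg: "0 \<le> P x y"
  unfolding walk_matrix_def
  by (intro sum_nonneg mult_nonneg_nonneg lift_nonneg less_imp_le[OF \<alpha>_pos])

lemma P_pos_stem:
  assumes "P x y \<noteq> 0"
  obtains i where "i \<in> {1..r}" "stem V i x = stem V i y"
proof -
  from assms obtain i where "i \<in> {1..r}" "lift_matrix r V rt p i x y \<noteq> 0"
    unfolding walk_matrix_def by (metis (no_types, lifting) mult_zero_right sum.neutral)
  with that show thesis by (auto simp: lift_matrix_def split: if_splits)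
qed

text \<open>
  A step changes only the last letter, so a first letter that is not also the last one is a mere
  label.  This is the self-similarity behind the proof: above a letter, the walk is a copy of itself.
\<close>

lemma P_Cons_Cons:
  assumes "s # w \<in> W" "s' # w' \<in> W" "w \<noteq> [] \<or> w' \<noteq> []"
  shows "P (s # w) (s' # w') = (if s = s' then P w w' else 0)"
proof -
  obtain j where j: "j \<in> {1..r}" "s \<in> letters j" "w \<in> not_starting j"
    using assms(1) by (rule Cons_in_W_E)
  obtain j' where j': "j' \<in> {1..r}" "s' \<in> letters j'" "w' \<in> not_starting j'"
    using assms(2) by (rule Cons_in_W_E)
  have W: "w \<in> W" "w' \<in> W" using j j' not_starting_subset by auto
  have "lift_matrix r V rt p i (s # w) (s' # w') =
      (if s = s' then lift_matrix r V rt p i w w' else 0)" if i: "i \<in> {1..r}" for i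
  proof (cases "w \<noteq> [] \<and> w' \<noteq> []")
    case True
    with assms W show ?thesis by (auto simp: lift_matrix_def stem_def letter_def)
  next
    case False
    have **: "lift_matrix r V rt p i (s # w) [s'] = (if s = s' then lift_matrix r V rt p i w [] else 0)
       \<and> lift_matrix r V rt p i [s'] (s # w) = (if s = s' then lift_matrix r V rt p i [] w else 0)"
      if *: "w \<noteq> []" "w \<in> not_starting j" "s \<in> letters j" "s' \<in> letters j'" "j \<in> {1..r}" "j' \<in> {1..r}"
      for s s' w j j'
    proof -
      have W: "w \<in> W" "s # w \<in> W" "[s'] \<in> W" using *
        by (auto simp: Cons_in_W_iff not_starting_def)
      show ?thesis
      proof (cases "length w = 1 \<and> last w \<in> V i")
        case True
        then obtain t where w: "w = [t]" by (cases w) auto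
        with True * have "s \<notin> V i"
          using factor_unique[OF i \<open>j \<in> {1..r}\<close>] by (auto simp: not_starting_def letters_def)
        then show ?thesis using W True w by (auto simp: lift_matrix_def stem_def letter_def)
      next
        case False
        then have "stem V i w \<noteq> []" using *(1) by (cases w) (auto simp: stem_def)
        moreover from this have "length (stem V i (s # w)) \<ge> 2"
          using *(1) by (cases w) (auto simp: stem_def Suc_le_eq split: if_splits)
        moreover have "length (stem V i [s']) \<le> 1" "stem V i [] = []"
          by (auto simp: stem_def)
        ultimately show ?thesis using W by (auto simp: lift_matrix_def)
      qed
    qed
    show ?thesis
    proof (cases "w = []")
      case True
      then show ?thesis using **[of w' j' s' s j] assms(3) j j' by auto
    next
      case w: False
      then have "w' = []" using False by auto
      then show ?thesis using **[of w j s s' j'] w j j' by auto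
    qed
  qed
  then show ?thesis unfolding walk_matrix_def by (cases "s = s'") simp_all
qed

lemma P_eq_lift:
  assumes "j \<in> {1..r}" "\<And>i. i \<in> {1..r} \<Longrightarrow> i \<noteq> j \<Longrightarrow> lift_matrix r V rt p i x y = 0"
  shows "P x y = \<alpha> j * lift_matrix r V rt p j x y"
proof -
  have "P x y = (\<Sum>i\<in>{j}. \<alpha> i * lift_matrix r V rt p i x y)"
    unfolding walk_matrix_def using assms by (intro sum.mono_neutral_right) auto
  then show ?thesis by simp
qed

lemma singleton_in_W: "j \<in> {1..r} \<Longrightarrow> s \<in> letters j \<Longrightarrow> [s] \<in> W"
  using Cons_in_W_iff[of j s "[]"] by (simp add: not_starting_def)

lemma letter_singleton:
  assumes "j \<in> {1..r}" "s \<in> letters j" "i \<in> {1..r}"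
  shows "stem V i [s] = (if i = j then [] else [s])" "letter V rt i [s] = (if i = j then s else rt i)"
proof -
  have "s \<in> V i \<longleftrightarrow> i = j"
    using assms factor_unique letters_factor by blast
  then show "stem V i [s] = (if i = j then [] else [s])" "letter V rt i [s] = (if i = j then s else rt i)"
    by (simp_all add: stem_def letter_def)
qed

lemma stem_letter_Nil: "stem V i [] = []" "letter V rt i [] = rt i"
  by (simp_all add: stem_def letter_def)

lemma P_Nil_Nil: "P [] [] = 0"
  unfolding walk_matrix_def lift_matrix_def stem_letter_Nil
  by (intro sum.neutral) (simp add: no_loops root_in_factor)

lemma P_Nil_singleton:
  assumes "j \<in> {1..r}" "s \<in> letters j"
  shows "P [] [s] = \<alpha> j * p j (rt j) s" and "P [s] [] = \<alpha> j * p j s (rt j)"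
proof -
  note st = letter_singleton[OF assms]
  have "lift_matrix r V rt p i [] [s] = (if i = j then p j (rt j) s else 0)"
    and "lift_matrix r V rt p i [s] [] = (if i = j then p j s (rt j) else 0)" if "i \<in> {1..r}" for i
    using st[OF that] singleton_in_W[OF assms]
    by (cases "i = j"; simp add: lift_matrix_def stem_letter_Nil)+
  with P_eq_lift[OF assms(1)] assms(1)
  show "P [] [s] = \<alpha> j * p j (rt j) s" and "P [s] [] = \<alpha> j * p j s (rt j)" by simp_all
qed

lemma P_singletons:
  assumes "j \<in> {1..r}" "s \<in> letters j" "i \<in> {1..r}" "t \<in> letters i"
  shows "P [s] [t] = (if i = j then \<alpha> j * p j s t else 0)"
proof -
  have *: "[s] \<in> W" "[t] \<in> W" using assms singleton_in_W by auto
  have "s = t \<Longrightarrow> i = j" using assms factor_unique letters_factor by metis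
  then have "lift_matrix r V rt p k [s] [t] = (if k = j \<and> i = j then p j s t else 0)"
    if "k \<in> {1..r}" for k
    using letter_singleton[OF assms(1,2) that] letter_singleton[OF assms(3,4) that] *
      no_loops[OF that root_in_factor[OF that]]
    by (cases "k = j"; cases "k = i"; cases "s = t"; simp add: lift_matrix_def)
  with P_eq_lift[OF assms(1)] assms(1) show ?thesis by simp
qed

lemma P_Nil_long:
  assumes "s # w \<in> W" "w \<noteq> []"
  shows "P [] (s # w) = 0" "P (s # w) [] = 0"
proof -
  have "stem V i (s # w) \<noteq> []" for i using assms(2) by (auto simp: stem_def)
  then have "lift_matrix r V rt p i [] (s # w) = 0" "lift_matrix r V rt p i (s # w) [] = 0" for i
    by (metis lift_matrix_def stem_letter_Nil(1))+
  then show "P [] (s # w) = 0" "P (s # w) [] = 0" by (simp_all add: walk_matrix_def)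
qed

section \<open>Last visits\<close>

lemma Nil_notin_starting: "[] \<notin> starting j"
  by (simp add: starting_def)

lemma sum_over_W:
  "(\<integral>\<^sup>+x. f x \<partial>count_space W) = f [] + (\<Sum>j=1..r. \<integral>\<^sup>+x. f x \<partial>count_space (starting j))"
  for f :: "'a list \<Rightarrow> ennreal"
  by (subst W_split, rule nn_integral_count_space_insert_UN)
     (auto simp: disjoint_starting[simplified] Nil_notin_starting)

lemma sum_over_not_starting:
  "j \<in> {1..r} \<Longrightarrow> (\<integral>\<^sup>+x. f x \<partial>count_space (not_starting j)) =
    f [] + (\<Sum>i\<in>{1..r} - {j}. \<integral>\<^sup>+x. f x \<partial>count_space (starting i))"
  for f :: "'a list \<Rightarrow> ennreal"
  by (subst not_starting_split, simp, rule nn_integral_count_space_insert_UN)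
     (auto simp: Nil_notin_starting intro: disjoint_family_on_mono[OF _ disjoint_starting])

lemma sum_over_starting:
  fixes f :: "'a list \<Rightarrow> ennreal"
  assumes j: "j \<in> {1..r}"
  shows "(\<integral>\<^sup>+x. f x \<partial>count_space (starting j)) =
    (\<integral>\<^sup>+s. \<integral>\<^sup>+w. f (s # w) \<partial>count_space (not_starting j) \<partial>count_space (letters j))"
proof -
  have "(\<integral>\<^sup>+x. f x \<partial>count_space (starting j)) =
      (\<integral>\<^sup>+z. f ((\<lambda>(s, w). s # w) z) \<partial>count_space (letters j \<times> not_starting j))"
    by (rule nn_integral_bij_count_space[symmetric])
       (auto simp: bij_betw_def inj_on_def starting_eq[OF j])
  also have "\<dots> = (\<integral>\<^sup>+s. \<integral>\<^sup>+w. f (s # w) \<partial>count_space (not_starting j) \<partial>count_space (letters j))"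
    by (subst nn_integral_count_space_times)
       (auto simp: countable_letters[OF j] intro: countable_subset[OF not_starting_subset countable_W])
  finally show ?thesis .
qed

text \<open>
  \<open>occ n\<close> is the law of the walk at time \<open>n\<close>, and \<open>taboo n\<close> is its part carried by paths that do not
  visit the empty word at the times \<open>1, \<dots>, n\<close>.  Recursion on the last step fits the decompositions
  at a last visit below, because the factor that changes in them is the later part of the path.
\<close>

primrec occ :: "nat \<Rightarrow> 'a list \<Rightarrow> ennreal" where
  "occ 0 y = (if y = [] then 1 else 0)"
| "occ (Suc n) y = (\<integral>\<^sup>+x. occ n x * P x y \<partial>count_space W)"

primrec taboo :: "nat \<Rightarrow> 'a list \<Rightarrow> ennreal" where
  "taboo 0 y = (if y = [] then 1 else 0)"
| "taboo (Suc n) y = (if y = [] then 0 else \<integral>\<^sup>+x. taboo n x * P x y \<partial>count_space W)"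

lemma taboo_Nil: "taboo n [] = (if n = 0 then 1 else 0)"
  by (cases n) auto

lemma occ_Suc_last_visit:
  assumes "\<And>x. occ n x = (\<Sum>m\<le>n. occ m [] * taboo (n - m) x)"
  shows "occ (Suc n) y = (\<Sum>m\<le>n. occ m [] * (\<integral>\<^sup>+x. taboo (n - m) x * P x y \<partial>count_space W))"
proof -
  have "occ (Suc n) y = (\<integral>\<^sup>+x. (\<Sum>m\<le>n. occ m [] * (taboo (n - m) x * P x y)) \<partial>count_space W)"
    by (simp add: assms sum_distrib_right mult.assoc)
  also have "\<dots> = (\<Sum>m\<le>n. occ m [] * (\<integral>\<^sup>+x. taboo (n - m) x * P x y \<partial>count_space W))"
    by (simp add: nn_integral_sum nn_integral_cmult)
  finally show ?thesis .
qed

text \<open>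
  Between the last visit to the empty word and time \<open>n\<close> the walk avoids it.  No paths are needed
  for the proof: both sides obey the same forward recursion in \<open>n\<close>.
\<close>

lemma occ_last_visit: "occ n y = (\<Sum>m\<le>n. occ m [] * taboo (n - m) y)"
proof (induction n arbitrary: y)
  case 0
  show ?case by simp
next
  case (Suc n)
  show ?case
  proof (cases "y = []")
    case True
    have "(\<Sum>m\<le>Suc n. occ m [] * taboo (Suc n - m) []) = (\<Sum>m\<in>{Suc n}. occ m [] * taboo (Suc n - m) [])"
      by (intro sum.mono_neutral_right) (auto simp: taboo_Nil)
    with True show ?thesis by simp
  next
    case False
    have "(\<Sum>m\<le>Suc n. occ m [] * taboo (Suc n - m) y) = (\<Sum>m\<le>n. occ m [] * taboo (Suc n - m) y)"
      using False by simp
    also have "\<dots> = (\<Sum>m\<le>n. occ m [] * (\<integral>\<^sup>+x. taboo (n - m) x * P x y \<partial>count_space W))"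
      using False by (intro sum.cong) (auto simp: Suc_diff_le)
    finally show ?thesis using occ_Suc_last_visit[OF Suc.IH] by simp
  qed
qed

text \<open>
  A word with at least two letters can only be entered from a word with the same first letter.
\<close>

lemma step_into_cone:
  fixes f :: "'a list \<Rightarrow> ennreal"
  assumes j: "j \<in> {1..r}" "s \<in> letters j" and w: "w \<in> not_starting j" "w \<noteq> []"
  shows "(\<integral>\<^sup>+x. f x * P x (s # w) \<partial>count_space W) =
    (\<integral>\<^sup>+w'. f (s # w') * P w' w \<partial>count_space (not_starting j))"
proof -
  have sw: "s # w \<in> W" using j w Cons_in_W_iff by blast
  have sub: "(#) s ` not_starting j \<subseteq> W"
    using j by (auto simp: Cons_in_W_iff)
  have "(\<integral>\<^sup>+x. f x * P x (s # w) \<partial>count_space W) =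
      (\<integral>\<^sup>+x. f x * P x (s # w) \<partial>count_space ((#) s ` not_starting j))"
  proof (rule nn_integral_count_space_eq)
    fix x assume x: "x \<in> W - (#) s ` not_starting j"
    have "P x (s # w) = 0"
    proof (cases x)
      case Nil
      then show ?thesis using P_Nil_long[OF sw w(2)] by simp
    next
      case (Cons t u)
      have "t \<noteq> s"
      proof
        assume "t = s"
        with Cons x Cons_in_W_iff[OF j, of u] have "u \<in> not_starting j" by blast
        with Cons x \<open>t = s\<close> show False by blast
      qed
      moreover have "t # u \<in> W" using Cons x by blast
      ultimately show ?thesis using P_Cons_Cons[OF _ sw, of t u] w(2) Cons by simp
    qed
    then show "f x * P x (s # w) = 0" by simp
  next
    fix x assume "x \<in> (#) s ` not_starting j - W"
    with sub show "f x * P x (s # w) = 0" by blast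
  qed
  also have "\<dots> = (\<integral>\<^sup>+w'. f (s # w') * P (s # w') (s # w) \<partial>count_space (not_starting j))"
    by (rule nn_integral_bij_count_space[symmetric]) (auto simp: bij_betw_def)
  also have "\<dots> = (\<integral>\<^sup>+w'. f (s # w') * P w' w \<partial>count_space (not_starting j))"
  proof (rule nn_integral_cong)
    fix w' assume "w' \<in> space (count_space (not_starting j))"
    then have "s # w' \<in> W" using Cons_in_W_iff[OF j] by simp
    then show "f (s # w') * P (s # w') (s # w) = f (s # w') * P w' w"
      using P_Cons_Cons[OF _ sw, of s w'] w(2) by simp
  qed
  finally show ?thesis .
qed

lemma step_to_not_starting:
  fixes f :: "'a list \<Rightarrow> ennreal"
  assumes j: "j \<in> {1..r}" and w: "w \<in> not_starting j" "w \<noteq> []"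
  shows "(\<integral>\<^sup>+x. f x * P x w \<partial>count_space W) = (\<integral>\<^sup>+x. f x * P x w \<partial>count_space (not_starting j))"
proof (rule nn_integral_count_space_eq)
  fix x assume x: "x \<in> W - not_starting j"
  then obtain s u where xs: "x = s # u" "s # u \<in> W" "s \<in> V j" by (cases x) (auto simp: not_starting_def)
  obtain t v where wt: "w = t # v" "t # v \<in> W" "t \<notin> V j"
    using w by (cases w) (auto simp: not_starting_def)
  from wt obtain i where i: "i \<in> {1..r}" "t \<in> letters i" by (meson Cons_in_W_E)
  from xs obtain i' where i': "i' \<in> {1..r}" "s \<in> letters i'" by (meson Cons_in_W_E)
  have "i' = j" "i \<noteq> j" using i i' j xs(3) wt(3) factor_unique letters_factor by blast+
  then have "P [s] [t] = 0" using P_singletons[OF i'(1,2) i(1,2)] by simp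
  moreover have "s \<noteq> t" using xs wt by auto
  ultimately have "P x w = 0"
    using P_Cons_Cons[of s u t v] xs wt by auto
  then show "f x * P x w = 0" by simp
qed (use not_starting_subset in auto)

text \<open>
  Decomposition at the last visit to the one-letter word \<open>s\<close>: afterwards the walk stays strictly
  above \<open>s\<close>, which by self-similarity has the same probability as staying away from the empty word.
\<close>

lemma taboo_Cons:
  assumes j: "j \<in> {1..r}" "s \<in> letters j" and w: "w \<in> not_starting j"
  shows "taboo n (s # w) = (\<Sum>m\<le>n. taboo m [s] * taboo (n - m) w)"
  using w
proof (induction n arbitrary: w)
  case 0
  show ?case by simp
next
  case (Suc n)
  show ?case
  proof (cases "w = []")
    case True
    have "(\<Sum>m\<le>Suc n. taboo m [s] * taboo (Suc n - m) []) =
        (\<Sum>m\<in>{Suc n}. taboo m [s] * taboo (Suc n - m) [])"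
      by (intro sum.mono_neutral_right) (auto simp: taboo_Nil)
    with True show ?thesis by simp
  next
    case False
    have "taboo (Suc n) (s # w) = (\<integral>\<^sup>+x. taboo n x * P x (s # w) \<partial>count_space W)"
      by simp
    also have "\<dots> = (\<integral>\<^sup>+w'. taboo n (s # w') * P w' w \<partial>count_space (not_starting j))"
      by (rule step_into_cone[OF j Suc.prems False])
    also have "\<dots> = (\<integral>\<^sup>+w'. (\<Sum>m\<le>n. taboo m [s] * (taboo (n - m) w' * P w' w)) \<partial>count_space (not_starting j))"
      by (intro nn_integral_cong) (simp add: Suc.IH sum_distrib_right mult.assoc)
    also have "\<dots> = (\<Sum>m\<le>n. taboo m [s] * (\<integral>\<^sup>+w'. taboo (n - m) w' * P w' w \<partial>count_space (not_starting j)))"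
      by (simp add: nn_integral_sum nn_integral_cmult)
    also have "\<dots> = (\<Sum>m\<le>n. taboo m [s] * taboo (Suc n - m) w)"
      using False
      by (intro sum.cong) (auto simp: Suc_diff_le step_to_not_starting[OF j(1) Suc.prems False])
    also have "\<dots> = (\<Sum>m\<le>Suc n. taboo m [s] * taboo (Suc n - m) w)"
      using False by simp
    finally show ?thesis .
  qed
qed

lemma taboo_le_occ: "taboo n y \<le> occ n y"
proof (induction n arbitrary: y)
  case (Suc n)
  show ?case by (auto intro!: nn_integral_mono mult_right_mono Suc.IH)
qed auto

section \<open>Letter weights and first returns\<close>

lemma row_sum_factor:
  assumes "j \<in> {1..r}" "x \<in> V j"
  shows "(\<integral>\<^sup>+s. p j x s \<partial>count_space (letters j)) + p j x (rt j) = 1"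
proof -
  have "(\<integral>\<^sup>+s. p j x s \<partial>count_space (V j)) = 1"
    using stochastic[OF assms(1)] assms(2) nn_integral_count_space_has_sum[where f = "p j x" and c = 1 and A = "V j"]
    by (auto simp: transition_matrix_def)
  moreover have split: "V j = {rt j} \<union> (\<Union>i\<in>{j}. letters i)"
    using root_in_factor[OF assms(1)] by (auto simp: letters_def)
  have "(\<integral>\<^sup>+s. p j x s \<partial>count_space (V j)) = p j x (rt j) + (\<Sum>i\<in>{j}. \<integral>\<^sup>+s. p j x s \<partial>count_space (letters i))"
    by (subst split, rule nn_integral_count_space_insert_UN) (auto simp: letters_def disjoint_family_on_def)
  ultimately show ?thesis by (simp add: add.commute)
qed

text \<open>
  The names follow the potential theory of the walk: \<open>green\<close> is \<open>G(o,o|z)\<close>, \<open>weight z x\<close> is the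
  last-visit generating function \<open>L(o,x|z)\<close>, and \<open>return_gf j\<close> counts first returns to the empty word
  whose last step comes from \<open>V j\<close>.
\<close>

definition green :: "ennreal \<Rightarrow> ennreal" where
  "green z = gf (\<lambda>n. occ n []) z"

definition weight :: "ennreal \<Rightarrow> 'a list \<Rightarrow> ennreal" where
  "weight z x = gf (\<lambda>n. taboo n x) z"

definition letter_mass :: "nat \<Rightarrow> nat \<Rightarrow> ennreal" where
  "letter_mass j n = (\<integral>\<^sup>+s. taboo n [s] \<partial>count_space (letters j))"

definition letter_gf :: "nat \<Rightarrow> ennreal \<Rightarrow> ennreal" where
  "letter_gf j z = gf (letter_mass j) z"

definition return_mass :: "nat \<Rightarrow> nat \<Rightarrow> ennreal" where
  "return_mass j n = (\<integral>\<^sup>+x. taboo n x * P x [] \<partial>count_space (starting j))"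

definition return_gf :: "nat \<Rightarrow> ennreal \<Rightarrow> ennreal" where
  "return_gf j z = z * gf (return_mass j) z"

lemma gf_occ: "gf (\<lambda>n. occ n x) z = green z * weight z x"
  unfolding green_def weight_def by (subst occ_last_visit) (rule gf_convolution)

lemma weight_Nil [simp]: "weight z [] = 1"
proof -
  have "weight z [] = (\<Sum>n\<in>{0}. (if n = 0 then 1 else 0) * z ^ n)"
    unfolding weight_def gf_def taboo_Nil by (rule suminf_finite) auto
  then show ?thesis by simp
qed

lemma weight_Cons:
  assumes "j \<in> {1..r}" "s \<in> letters j" "w \<in> not_starting j"
  shows "weight z (s # w) = weight z [s] * weight z w"
  unfolding weight_def by (subst taboo_Cons[OF assms]) (rule gf_convolution)

lemma letter_gf_eq: "letter_gf j z = (\<integral>\<^sup>+s. weight z [s] \<partial>count_space (letters j))"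
  unfolding letter_gf_def letter_mass_def weight_def by (simp add: gf_nn_integral)

text \<open>
  The function \<open>h\<close> of the block length is arbitrary because three choices occur: the constant \<open>1\<close>,
  the powers of \<open>b\<close>, and the truncated powers that make an induction on the block length possible.
\<close>

definition block_sum :: "nat \<Rightarrow> (nat \<Rightarrow> ennreal) \<Rightarrow> ennreal \<Rightarrow> ennreal" where
  "block_sum j h z = (\<integral>\<^sup>+x. weight z x * h (length x) \<partial>count_space (starting j))"

text \<open>
  Weights are multiplicative and the second letter may come from any other factor.
\<close>

lemma block_sum_rec:
  assumes j: "j \<in> {1..r}"
  shows "block_sum j h z =
    letter_gf j z * (h 1 + (\<Sum>i\<in>{1..r} - {j}. block_sum i (\<lambda>n. h (Suc n)) z))"
proof -
  have "block_sum j h z = (\<integral>\<^sup>+s. \<integral>\<^sup>+w. weight z (s # w) * h (Suc (length w))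
      \<partial>count_space (not_starting j) \<partial>count_space (letters j))"
    unfolding block_sum_def by (simp add: sum_over_starting[OF j])
  also have "\<dots> = (\<integral>\<^sup>+s. \<integral>\<^sup>+w. weight z [s] * (weight z w * h (Suc (length w)))
      \<partial>count_space (not_starting j) \<partial>count_space (letters j))"
    by (intro nn_integral_cong) (simp add: weight_Cons[OF j] mult.assoc)
  also have "\<dots> = letter_gf j z * (\<integral>\<^sup>+w. weight z w * h (Suc (length w)) \<partial>count_space (not_starting j))"
    by (simp add: letter_gf_eq nn_integral_cmult nn_integral_multc)
  also have "(\<integral>\<^sup>+w. weight z w * h (Suc (length w)) \<partial>count_space (not_starting j)) =
      h 1 + (\<Sum>i\<in>{1..r} - {j}. block_sum i (\<lambda>n. h (Suc n)) z)"
    unfolding block_sum_def by (simp add: sum_over_not_starting[OF j])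
  finally show ?thesis .
qed

text \<open>
  The last letter of \<open>[s]\<close> has type \<open>j\<close>, so \<open>[s]\<close> is entered from the empty word, from another letter
  of the same factor, or from a word that has one more letter than \<open>[s]\<close>.
\<close>

lemma step_to_letter:
  fixes f :: "'a list \<Rightarrow> ennreal"
  assumes j: "j \<in> {1..r}" "s \<in> letters j"
  shows "(\<integral>\<^sup>+x. f x * P x [s] \<partial>count_space W) = f [] * (\<alpha> j * p j (rt j) s)
     + (\<integral>\<^sup>+t. f [t] * (\<alpha> j * p j t s) \<partial>count_space (letters j))
     + (\<Sum>k\<in>{1..r} - {j}. \<integral>\<^sup>+w. f (s # w) * P w [] \<partial>count_space (starting k))"
    (is "_ = _ + _ + ?X")
proof -
  have cone: "(\<integral>\<^sup>+w. f (t # w) * P (t # w) [s] \<partial>count_space (not_starting i)) =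
      (if i = j then f [t] * (\<alpha> j * p j t s) + (if t = s then ?X else 0) else 0)"
    if i: "i \<in> {1..r}" and t: "t \<in> letters i" for i t
  proof -
    have ts: "t = s \<Longrightarrow> i = j" using i t j factor_unique letters_factor by metis
    have "(\<integral>\<^sup>+w. f (t # w) * P (t # w) [s] \<partial>count_space (not_starting i)) =
      f [t] * P [t] [s] + (\<Sum>k\<in>{1..r} - {i}. \<integral>\<^sup>+w. f (t # w) * P (t # w) [s] \<partial>count_space (starting k))"
      by (rule sum_over_not_starting[OF i])
    also have "(\<Sum>k\<in>{1..r} - {i}. \<integral>\<^sup>+w. f (t # w) * P (t # w) [s] \<partial>count_space (starting k)) =
        (\<Sum>k\<in>{1..r} - {i}. \<integral>\<^sup>+w. (if t = s then f (s # w) * P w [] else 0) \<partial>count_space (starting k))"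
    proof (intro sum.cong nn_integral_cong refl)
      fix k w assume k: "k \<in> {1..r} - {i}" and "w \<in> space (count_space (starting k))"
      then have w: "w \<in> starting k" by simp
      then have "w \<in> not_starting i" unfolding not_starting_split[OF i] using k by blast
      then have "t # w \<in> W" using Cons_in_W_iff[OF i t] by blast
      moreover have "w \<noteq> []" using w by (auto simp: starting_def)
      ultimately have "P (t # w) [s] = (if t = s then P w [] else 0)"
        using P_Cons_Cons singleton_in_W[OF j] by blast
      then show "f (t # w) * P (t # w) [s] = (if t = s then f (s # w) * P w [] else 0)"
        by simp
    qed
    also have "f [t] * P [t] [s] = (if i = j then f [t] * (\<alpha> j * p j t s) else 0)"
      using P_singletons[OF i t j] by auto
    finally show ?thesis using ts by (cases "t = s"; cases "i = j") simp_all
  qed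
  have "(\<integral>\<^sup>+x. f x * P x [s] \<partial>count_space (starting i)) =
      (if i = j then \<integral>\<^sup>+t. (f [t] * (\<alpha> j * p j t s) + ?X * indicator {s} t) \<partial>count_space (letters j) else 0)"
    if i: "i \<in> {1..r}" for i
  proof -
    have "(\<integral>\<^sup>+x. f x * P x [s] \<partial>count_space (starting i)) = (\<integral>\<^sup>+t. 
       (if i = j then f [t] * (\<alpha> j * p j t s) + ?X * indicator {s} t else 0) \<partial>count_space (letters i))"
      unfolding sum_over_starting[OF i]
      by (intro nn_integral_cong) (simp add: cone[OF i] indicator_def)
    then show ?thesis by simp
  qed
  then have "(\<Sum>i=1..r. \<integral>\<^sup>+x. f x * P x [s] \<partial>count_space (starting i)) =
      (\<integral>\<^sup>+t. (f [t] * (\<alpha> j * p j t s) + ?X * indicator {s} t) \<partial>count_space (letters j))"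
    using j(1) by (simp add: sum.delta)
  also have "\<dots> = (\<integral>\<^sup>+t. f [t] * (\<alpha> j * p j t s) \<partial>count_space (letters j)) +
      (\<integral>\<^sup>+t. ?X * indicator {s} t \<partial>count_space (letters j))"
    by (rule nn_integral_add) auto
  also have "(\<integral>\<^sup>+t. ?X * indicator {s} t \<partial>count_space (letters j)) = ?X"
    using j(2) by (simp add: nn_integral_cmult_indicator)
  finally show ?thesis
    by (simp add: sum_over_W P_Nil_singleton[OF j] add.assoc)
qed

lemma return_mass_eq:
  assumes j: "j \<in> {1..r}"
  shows "return_mass j n = (\<integral>\<^sup>+t. taboo n [t] * (\<alpha> j * p j t (rt j)) \<partial>count_space (letters j))"
proof -
  have "(\<integral>\<^sup>+w. taboo n (t # w) * P (t # w) [] \<partial>count_space (not_starting j)) =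
      taboo n [t] * (\<alpha> j * p j t (rt j))" if t: "t \<in> letters j" for t
  proof -
    have "(\<Sum>i\<in>{1..r} - {j}. \<integral>\<^sup>+w. taboo n (t # w) * P (t # w) [] \<partial>count_space (starting i)) =
        (\<Sum>i\<in>{1..r} - {j}. \<integral>\<^sup>+w. 0 \<partial>count_space (starting i))"
    proof (intro sum.cong nn_integral_cong refl)
      fix k w assume k: "k \<in> {1..r} - {j}" and "w \<in> space (count_space (starting k))"
      then have w: "w \<in> starting k" by simp
      then have "w \<in> not_starting j" unfolding not_starting_split[OF j] using k by blast
      then have "t # w \<in> W" using Cons_in_W_iff[OF j t] by blast
      moreover have "w \<noteq> []" using w by (auto simp: starting_def)
      ultimately show "taboo n (t # w) * P (t # w) [] = 0" using P_Nil_long(2) by simp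
    qed
    then show ?thesis
      unfolding sum_over_not_starting[OF j] using P_Nil_singleton(2)[OF j t] by simp
  qed
  then show ?thesis
    unfolding return_mass_def sum_over_starting[OF j] by (intro nn_integral_cong) simp
qed

lemma letter_mass_0: "letter_mass j 0 = 0"
  by (simp add: letter_mass_def)

text \<open>
  Mass balance for the set of letters of \<open>V j\<close>.  The rows of \<open>p j\<close> sum to \<open>1\<close> only when the root is
  included; the missing mass is the return mass, which stands on the left since subtraction in
  \<open>[0, \<infinity>]\<close> is best avoided.  The convolution describes excursions above a letter that return to it:
  seen from the letter they are first returns through one of the other factors.
\<close>

lemma letter_mass_Suc:
  assumes j: "j \<in> {1..r}"
  shows "letter_mass j (Suc n) + return_mass j n =
    \<alpha> j * ((if n = 0 then 1 else 0) + letter_mass j n) +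
    (\<Sum>m\<le>n. letter_mass j m * (\<Sum>k\<in>{1..r} - {j}. return_mass k (n - m)))"
proof -
  have \<alpha>: "0 \<le> \<alpha> j" using \<alpha>_pos[OF j] by simp
  have cS: "countable (letters j)" using countable_letters[OF j] .
  have out: "(\<Sum>k\<in>{1..r} - {j}. \<integral>\<^sup>+w. taboo n (s # w) * P w [] \<partial>count_space (starting k)) =
      (\<Sum>m\<le>n. taboo m [s] * (\<Sum>k\<in>{1..r} - {j}. return_mass k (n - m)))"
    if s: "s \<in> letters j" for s
  proof -
    have "(\<integral>\<^sup>+w. taboo n (s # w) * P w [] \<partial>count_space (starting k)) =
        (\<Sum>m\<le>n. taboo m [s] * return_mass k (n - m))" if k: "k \<in> {1..r} - {j}" for k
    proof -
      have "(\<integral>\<^sup>+w. taboo n (s # w) * P w [] \<partial>count_space (starting k)) =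
          (\<integral>\<^sup>+w. (\<Sum>m\<le>n. taboo m [s] * (taboo (n - m) w * P w [])) \<partial>count_space (starting k))"
      proof (rule nn_integral_cong)
        fix w assume "w \<in> space (count_space (starting k))"
        then have "w \<in> not_starting j" unfolding not_starting_split[OF j] using k by auto
        from taboo_Cons[OF j s this] show "taboo n (s # w) * P w [] =
            (\<Sum>m\<le>n. taboo m [s] * (taboo (n - m) w * P w []))"
          by (simp add: sum_distrib_right mult.assoc)
      qed
      also have "\<dots> = (\<Sum>m\<le>n. taboo m [s] * return_mass k (n - m))"
        unfolding return_mass_def by (simp add: nn_integral_sum nn_integral_cmult)
      finally show ?thesis .
    qed
    then have "(\<Sum>k\<in>{1..r} - {j}. \<integral>\<^sup>+w. taboo n (s # w) * P w [] \<partial>count_space (starting k)) =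
        (\<Sum>k\<in>{1..r} - {j}. \<Sum>m\<le>n. taboo m [s] * return_mass k (n - m))"
      by (intro sum.cong) auto
    also have "\<dots> = (\<Sum>m\<le>n. \<Sum>k\<in>{1..r} - {j}. taboo m [s] * return_mass k (n - m))"
      by (rule sum.swap)
    finally show ?thesis by (simp add: sum_distrib_left)
  qed
  have root: "(\<integral>\<^sup>+s. p j (rt j) s \<partial>count_space (letters j)) = 1"
    using row_sum_factor[OF j root_in_factor[OF j]] no_loops[OF j root_in_factor[OF j]] by simp
  have "letter_mass j (Suc n) = (\<integral>\<^sup>+s. taboo n [] * (\<alpha> j * p j (rt j) s)
     + (\<integral>\<^sup>+t. taboo n [t] * (\<alpha> j * p j t s) \<partial>count_space (letters j))
     + (\<Sum>m\<le>n. taboo m [s] * (\<Sum>k\<in>{1..r} - {j}. return_mass k (n - m))) \<partial>count_space (letters j))"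
    unfolding letter_mass_def
    by (intro nn_integral_cong) (simp add: step_to_letter[OF j] out del: One_nat_def)
  also have "\<dots> = (\<integral>\<^sup>+s. taboo n [] * (\<alpha> j * p j (rt j) s) \<partial>count_space (letters j))
     + (\<integral>\<^sup>+s. \<integral>\<^sup>+t. taboo n [t] * (\<alpha> j * p j t s) \<partial>count_space (letters j) \<partial>count_space (letters j))
     + (\<integral>\<^sup>+s. (\<Sum>m\<le>n. taboo m [s] * (\<Sum>k\<in>{1..r} - {j}. return_mass k (n - m))) \<partial>count_space (letters j))"
    by (simp add: nn_integral_add)
  also have "(\<integral>\<^sup>+s. (\<Sum>m\<le>n. taboo m [s] * (\<Sum>k\<in>{1..r} - {j}. return_mass k (n - m))) \<partial>count_space (letters j)) =
      (\<Sum>m\<le>n. letter_mass j m * (\<Sum>k\<in>{1..r} - {j}. return_mass k (n - m)))"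
    unfolding letter_mass_def by (simp add: nn_integral_sum nn_integral_multc)
  also have "(\<integral>\<^sup>+s. taboo n [] * (\<alpha> j * p j (rt j) s) \<partial>count_space (letters j)) =
      taboo n [] * (\<integral>\<^sup>+s. ennreal (\<alpha> j) * ennreal (p j (rt j) s) \<partial>count_space (letters j))"
    using \<alpha> by (simp add: nn_integral_cmult ennreal_mult')
  also have "\<dots> = \<alpha> j * (if n = 0 then 1 else 0)"
    by (simp add: nn_integral_cmult root taboo_Nil)
  also have "(\<integral>\<^sup>+s. \<integral>\<^sup>+t. taboo n [t] * (\<alpha> j * p j t s) \<partial>count_space (letters j) \<partial>count_space (letters j)) =
      (\<integral>\<^sup>+t. \<integral>\<^sup>+s. taboo n [t] * (\<alpha> j * p j t s) \<partial>count_space (letters j) \<partial>count_space (letters j))"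
    by (rule nn_integral_count_space_nn_integral) (auto simp: cS)
  also have "\<dots> = (\<integral>\<^sup>+t. \<alpha> j * taboo n [t] * (\<integral>\<^sup>+s. p j t s \<partial>count_space (letters j)) \<partial>count_space (letters j))"
    using \<alpha> by (simp add: nn_integral_cmult[symmetric] ennreal_mult' mult_ac)
  finally have 1: "letter_mass j (Suc n) = \<alpha> j * (if n = 0 then 1 else 0) +
     (\<integral>\<^sup>+t. \<alpha> j * taboo n [t] * (\<integral>\<^sup>+s. p j t s \<partial>count_space (letters j)) \<partial>count_space (letters j)) +
     (\<Sum>m\<le>n. letter_mass j m * (\<Sum>k\<in>{1..r} - {j}. return_mass k (n - m)))" .
  have "(\<integral>\<^sup>+t. \<alpha> j * taboo n [t] * (\<integral>\<^sup>+s. p j t s \<partial>count_space (letters j)) \<partial>count_space (letters j))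
      + return_mass j n =
      (\<integral>\<^sup>+t. \<alpha> j * taboo n [t] * (\<integral>\<^sup>+s. p j t s \<partial>count_space (letters j)) +
        taboo n [t] * (\<alpha> j * p j t (rt j)) \<partial>count_space (letters j))"
    unfolding return_mass_eq[OF j] by (rule nn_integral_add[symmetric]) auto
  also have "\<dots> = (\<integral>\<^sup>+t. \<alpha> j * taboo n [t] \<partial>count_space (letters j))"
  proof (rule nn_integral_cong)
    fix t assume "t \<in> space (count_space (letters j))"
    then have t: "t \<in> V j" by (simp add: letters_def)
    have "\<alpha> j * taboo n [t] * (\<integral>\<^sup>+s. p j t s \<partial>count_space (letters j)) +
        taboo n [t] * (\<alpha> j * p j t (rt j)) =
      \<alpha> j * taboo n [t] * ((\<integral>\<^sup>+s. p j t s \<partial>count_space (letters j)) + p j t (rt j))"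
      using \<alpha> by (simp add: distrib_left ennreal_mult' mult_ac)
    then show "\<alpha> j * taboo n [t] * (\<integral>\<^sup>+s. p j t s \<partial>count_space (letters j)) +
        taboo n [t] * (\<alpha> j * p j t (rt j)) = \<alpha> j * taboo n [t]"
      by (simp add: row_sum_factor[OF j t])
  qed
  also have "\<dots> = \<alpha> j * letter_mass j n"
    by (simp add: letter_mass_def nn_integral_cmult)
  finally have 2: "(\<integral>\<^sup>+t. \<alpha> j * taboo n [t] * (\<integral>\<^sup>+s. p j t s \<partial>count_space (letters j)) \<partial>count_space (letters j))
      + return_mass j n = \<alpha> j * letter_mass j n" .
  show ?thesis
    unfolding 1 distrib_left 2[symmetric] by (simp add: ac_simps)
qed

lemma letter_gf_eqn:
  assumes j: "j \<in> {1..r}"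
  shows "letter_gf j z + return_gf j z = z * \<alpha> j * (1 + letter_gf j z) +
     letter_gf j z * (\<Sum>k\<in>{1..r} - {j}. return_gf k z)"
proof -
  have one: "gf (\<lambda>n. if n = 0 then 1 else 0) z = 1"
    using weight_Nil by (simp add: weight_def taboo_Nil)
  have "letter_gf j z + return_gf j z = z * gf (\<lambda>n. letter_mass j (Suc n) + return_mass j n) z"
    unfolding letter_gf_def return_gf_def
    by (subst gf_Suc) (simp add: gf_add distrib_left letter_mass_0)
  also have "\<dots> = z * gf (\<lambda>n. \<alpha> j * ((if n = 0 then 1 else 0) + letter_mass j n) +
    (\<Sum>m\<le>n. letter_mass j m * (\<Sum>k\<in>{1..r} - {j}. return_mass k (n - m)))) z"
    by (simp add: letter_mass_Suc[OF j])
  also have "\<dots> = z * (\<alpha> j * (1 + letter_gf j z) + letter_gf j z * (\<Sum>k\<in>{1..r} - {j}. gf (return_mass k) z))"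
    using gf_convolution[of "letter_mass j" "\<lambda>n. \<Sum>k\<in>{1..r} - {j}. return_mass k n" z]
    unfolding letter_gf_def by (simp add: gf_add gf_cmult gf_sum one)
  finally show ?thesis
    unfolding return_gf_def by (simp add: distrib_left sum_distrib_left mult_ac)
qed

text \<open>
  The renewal equation for visits to the empty word.
\<close>

lemma green_eqn: "green z = 1 + green z * (\<Sum>j=1..r. return_gf j z)"
proof -
  have "occ (Suc n) [] = (\<Sum>m\<le>n. occ m [] * (\<Sum>j=1..r. return_mass j (n - m)))" for n
    unfolding occ_Suc_last_visit[OF occ_last_visit] sum_over_W return_mass_def
    by (simp add: P_Nil_Nil)
  then have "green z = 1 + z * gf (\<lambda>n. \<Sum>m\<le>n. occ m [] * (\<Sum>j=1..r. return_mass j (n - m))) z"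
    unfolding green_def by (subst gf_Suc) simp
  also have "gf (\<lambda>n. \<Sum>m\<le>n. occ m [] * (\<Sum>j=1..r. return_mass j (n - m))) z =
      green z * (\<Sum>j=1..r. gf (return_mass j) z)"
    unfolding green_def
    using gf_convolution[of "\<lambda>n. occ n []" "\<lambda>n. \<Sum>j=1..r. return_mass j n" z] unfolding gf_sum .
  also have "1 + z * (green z * (\<Sum>j=1..r. gf (return_mass j) z)) = 1 + green z * (\<Sum>j=1..r. return_gf j z)"
    unfolding return_gf_def by (simp add: sum_distrib_left mult_ac)
  finally show ?thesis .
qed

section \<open>Conservation of mass\<close>

text \<open>
  The words reachable through the \<open>i\<close>-th lift are the stem of \<open>x\<close> followed by an element of \<open>V i\<close>.
\<close>

lemma row_sum_lift:
  assumes i: "i \<in> {1..r}" and x: "x \<in> W"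
  shows "(\<integral>\<^sup>+y. lift_matrix r V rt p i x y \<partial>count_space W) = 1"
proof -
  define z where "z = stem V i x"
  note st = app_letter_stem[where rt = rt, OF disjoint_factors i root_in_factor[OF i]]
  have z: "z \<in> W" "z = [] \<or> last z \<notin> V i" unfolding z_def using st(2,3)[OF x] by auto
  have img: "app_letter rt i z ` V i \<subseteq> W"
    using app_letter_in_free_product[OF disjoint_factors i z] by auto
  have inj: "inj_on (app_letter rt i z) (V i)"
    using stem_app_letter(2)[of z V i, OF z(2)] by (metis inj_onI)
  have "(\<integral>\<^sup>+y. lift_matrix r V rt p i x y \<partial>count_space W) =
      (\<integral>\<^sup>+y. lift_matrix r V rt p i x y \<partial>count_space (app_letter rt i z ` V i))"
  proof (rule nn_integral_count_space_eq)
    fix y assume y: "y \<in> W - app_letter rt i z ` V i"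
    then have "stem V i y \<noteq> z"
      using st(1,4)[of y] by (metis DiffE image_eqI)
    then show "ennreal (lift_matrix r V rt p i x y) = 0"
      by (simp add: lift_matrix_def z_def)
  qed (use img in auto)
  also have "\<dots> = (\<integral>\<^sup>+v. lift_matrix r V rt p i x (app_letter rt i z v) \<partial>count_space (V i))"
    by (rule nn_integral_bij_count_space[symmetric]) (simp add: bij_betw_def inj)
  also have "\<dots> = (\<integral>\<^sup>+v. p i (letter V rt i x) v \<partial>count_space (V i))"
  proof (intro nn_integral_cong)
    fix v assume "v \<in> space (count_space (V i))"
    then have v: "v \<in> V i" by simp
    show "ennreal (lift_matrix r V rt p i x (app_letter rt i z v)) = ennreal (p i (letter V rt i x) v)"
      using lift_matrix_app_letter[where p = p, OF disjoint_factors i z st(4)[OF x] v] st(1)[OF x, folded z_def]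
      by simp
  qed
  also have "\<dots> = 1"
    using stochastic[OF i] st(4)[OF x]
      nn_integral_count_space_has_sum[where f = "p i (letter V rt i x)" and c = 1 and A = "V i"]
    by (auto simp: transition_matrix_def)
  finally show ?thesis .
qed

lemma row_sum_P:
  assumes x: "x \<in> W"
  shows "(\<integral>\<^sup>+y. P x y \<partial>count_space W) = 1"
proof -
  have \<alpha>: "0 \<le> \<alpha> i" if "i \<in> {1..r}" for i using \<alpha>_pos[OF that] by simp
  have "ennreal (P x y) = (\<Sum>i=1..r. ennreal (\<alpha> i) * ennreal (lift_matrix r V rt p i x y))" for y
  proof -
    have "(\<Sum>i=1..r. ennreal (\<alpha> i) * ennreal (lift_matrix r V rt p i x y)) =
        (\<Sum>i=1..r. ennreal (\<alpha> i * lift_matrix r V rt p i x y))"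
      by (intro sum.cong refl ennreal_mult'[symmetric] \<alpha>)
    also have "\<dots> = ennreal (\<Sum>i=1..r. \<alpha> i * lift_matrix r V rt p i x y)"
      by (intro sum_ennreal mult_nonneg_nonneg \<alpha> lift_nonneg)
    finally show ?thesis by (simp add: walk_matrix_def)
  qed
  then have "(\<integral>\<^sup>+y. P x y \<partial>count_space W) =
      (\<Sum>i=1..r. ennreal (\<alpha> i) * (\<integral>\<^sup>+y. lift_matrix r V rt p i x y \<partial>count_space W))"
    by (simp add: nn_integral_sum nn_integral_cmult)
  also have "\<dots> = (\<Sum>i=1..r. ennreal (\<alpha> i))"
    by (intro sum.cong) (simp_all add: row_sum_lift[OF _ x])
  also have "\<dots> = ennreal (\<Sum>i=1..r. \<alpha> i)"
    by (intro sum_ennreal \<alpha>)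
  finally show ?thesis using \<alpha>_sum by simp
qed

lemma P_summable:
  assumes x: "x \<in> W"
  shows "(P x has_sum 1) W"
proof -
  have "integrable (count_space W) (P x)"
    by (intro integrableI_nonneg) (auto simp: P_nonneg row_sum_P[OF x])
  then have abs: "Infinite_Set_Sum.abs_summable_on (P x) W"
    by (simp add: Infinite_Set_Sum.abs_summable_on_def)
  then have "P x summable_on W"
    using abs_summable_equivalent summable_on_iff_abs_summable_on_real by blast
  then have hs: "(P x has_sum infsum (P x) W) W" by simp
  have "ennreal (infsum (P x) W) = 1"
    using nn_integral_count_space_has_sum[OF hs] P_nonneg row_sum_P[OF x] by simp
  moreover have "infsum (P x) W \<ge> 0" by (intro infsum_nonneg P_nonneg)
  ultimately have "infsum (P x) W = 1" by simp
  with hs show ?thesis by simp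
qed

text \<open>
  The two claims are proved together: boundedness by \<open>1\<close> gives the summability without which the
  infinite sum in \<open>n_step\<close> would be a default value.
\<close>

lemma n_step_bounds:
  assumes "x \<in> W"
  shows "0 \<le> n_step W P n x y \<and> n_step W P n x y \<le> 1"
    and "((\<lambda>w. P x w * n_step W P n w y) has_sum n_step W P (Suc n) x y) W"
  using assms
proof (induction n arbitrary: x)
  have step: "((\<lambda>w. P x w * n_step W P n w y) has_sum n_step W P (Suc n) x y) W \<and> n_step W P (Suc n) x y \<le> 1"
    if x: "x \<in> W" and IH: "\<And>w. w \<in> W \<Longrightarrow> 0 \<le> n_step W P n w y \<and> n_step W P n w y \<le> 1" for x n
  proof -
    have bd: "P x w * n_step W P n w y \<le> P x w" if "w \<in> W" for w
      using IH[OF that] P_nonneg by (simp add: mult_left_le)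
    have Px: "P x summable_on W" using P_summable[OF x] by (rule has_sum_imp_summable)
    then have "(\<lambda>w. P x w * n_step W P n w y) summable_on W"
      by (rule summable_on_comparison_test) (use bd IH P_nonneg in auto)
    moreover from this have "n_step W P (Suc n) x y \<le> infsum (P x) W"
      using Px bd by (auto intro: infsum_mono)
    ultimately show ?thesis using infsumI[OF P_summable[OF x]] by simp
  qed
  case 0
  {
    case 1
    then show ?case by simp
  next
    case 2
    then show ?case using step[of _ 0] by simp
  }
  case (Suc n)
  {
    case 1
    have "0 \<le> n_step W P (Suc n) x y"
      using Suc.IH(1) P_nonneg by (auto intro!: infsum_nonneg mult_nonneg_nonneg)
    then show ?case using step[OF 1 Suc.IH(1)] by simp
  next
    case 2
    have "0 \<le> n_step W P (Suc n) w y \<and> n_step W P (Suc n) w y \<le> 1" if w: "w \<in> W" for w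
    proof -
      have "0 \<le> n_step W P (Suc n) w y"
        using Suc.IH(1) P_nonneg by (auto intro!: infsum_nonneg mult_nonneg_nonneg)
      then show ?thesis using step[OF w Suc.IH(1)] by simp
    qed
    then show ?case using step[OF 2] by blast
  }
qed

text \<open>
  Moving steps from the backward recursion of \<open>n_step\<close> to the forward recursion of \<open>occ\<close>, one at
  a time, links the two.
\<close>

lemma occ_n_step:
  assumes "y \<in> W"
  shows "(\<integral>\<^sup>+x. occ m x * n_step W P n x y \<partial>count_space W) = occ (m + n) y"
proof (induction n arbitrary: m)
  case 0
  have "(\<integral>\<^sup>+x. occ m x * n_step W P 0 x y \<partial>count_space W) = (\<integral>\<^sup>+x. occ m y * indicator {y} x \<partial>count_space W)"
    by (intro nn_integral_cong) (auto simp: indicator_def)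
  also have "\<dots> = occ m y" using assms by (simp add: nn_integral_cmult_indicator)
  finally show ?case by simp
next
  case (Suc n)
  have "(\<integral>\<^sup>+x. occ m x * n_step W P (Suc n) x y \<partial>count_space W) =
      (\<integral>\<^sup>+x. \<integral>\<^sup>+w. occ m x * P x w * n_step W P n w y \<partial>count_space W \<partial>count_space W)"
  proof (intro nn_integral_cong)
    fix x assume "x \<in> space (count_space W)"
    then have x: "x \<in> W" by simp
    have "ennreal (n_step W P (Suc n) x y) = (\<integral>\<^sup>+w. ennreal (P x w * n_step W P n w y) \<partial>count_space W)"
      by (rule nn_integral_count_space_has_sum[symmetric, OF n_step_bounds(2)[OF x]])
         (use n_step_bounds(1) P_nonneg in auto)
    also have "\<dots> = (\<integral>\<^sup>+w. P x w * ennreal (n_step W P n w y) \<partial>count_space W)"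
      by (intro nn_integral_cong) (simp add: ennreal_mult' P_nonneg)
    finally show "occ m x * ennreal (n_step W P (Suc n) x y) =
        (\<integral>\<^sup>+w. occ m x * P x w * n_step W P n w y \<partial>count_space W)"
      by (simp add: nn_integral_cmult[symmetric] mult.assoc del: n_step.simps)
  qed
  also have "\<dots> = (\<integral>\<^sup>+w. \<integral>\<^sup>+x. occ m x * P x w * n_step W P n w y \<partial>count_space W \<partial>count_space W)"
    by (rule nn_integral_count_space_nn_integral) (auto simp: countable_W)
  also have "\<dots> = (\<integral>\<^sup>+w. occ (Suc m) w * n_step W P n w y \<partial>count_space W)"
    by (simp add: nn_integral_multc)
  also have "\<dots> = occ (m + Suc n) y" using Suc.IH[of "Suc m"] by simp
  finally show ?case .
qed

lemma occ_eq_n_step: "y \<in> W \<Longrightarrow> occ n y = n_step W P n [] y"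
proof -
  assume y: "y \<in> W"
  have "occ n y = (\<integral>\<^sup>+x. occ 0 x * n_step W P n x y \<partial>count_space W)"
    using occ_n_step[OF y, of 0 n] by simp
  also have "\<dots> = (\<integral>\<^sup>+x. n_step W P n [] y * indicator {[]} x \<partial>count_space W)"
    by (intro nn_integral_cong) (auto simp: indicator_def)
  finally show ?thesis by (simp add: nn_integral_cmult_indicator)
qed

lemma occ_total: "(\<integral>\<^sup>+x. occ n x \<partial>count_space W) = 1"
proof (induction n)
  case 0
  have "(\<integral>\<^sup>+x. occ 0 x \<partial>count_space W) = (\<integral>\<^sup>+x. 1 * indicator {[]} x \<partial>count_space W)"
    by (intro nn_integral_cong) (auto simp: indicator_def)
  then show ?case by (simp add: nn_integral_cmult_indicator)
next
  case (Suc n)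
  have "(\<integral>\<^sup>+y. occ (Suc n) y \<partial>count_space W) =
      (\<integral>\<^sup>+x. \<integral>\<^sup>+y. occ n x * P x y \<partial>count_space W \<partial>count_space W)"
    unfolding occ.simps by (rule nn_integral_count_space_nn_integral[symmetric]) (auto simp: countable_W)
  also have "\<dots> = (\<integral>\<^sup>+x. occ n x \<partial>count_space W)"
    by (intro nn_integral_cong) (simp add: nn_integral_cmult row_sum_P)
  finally show ?case using Suc.IH by simp
qed

lemma letter_mass_le_1:
  assumes j: "j \<in> {1..r}"
  shows "letter_mass j n \<le> 1"
proof -
  have "letter_mass j n = (\<integral>\<^sup>+x. taboo n x \<partial>count_space ((\<lambda>s. [s]) ` letters j))"
    unfolding letter_mass_def
    by (rule nn_integral_bij_count_space[where f = "taboo n"]) (auto simp: bij_betw_def inj_on_def)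
  also have "\<dots> \<le> (\<integral>\<^sup>+x. occ n x \<partial>count_space ((\<lambda>s. [s]) ` letters j))"
    by (intro nn_integral_mono taboo_le_occ)
  also have "\<dots> = (\<integral>\<^sup>+x. occ n x * indicator ((\<lambda>s. [s]) ` letters j) x \<partial>count_space UNIV)"
    by (rule nn_integral_count_space_indicator) simp
  also have "\<dots> \<le> (\<integral>\<^sup>+x. occ n x * indicator W x \<partial>count_space UNIV)"
    using singleton_in_W[OF j] by (intro nn_integral_mono mult_left_mono) (auto simp: indicator_def)
  also have "\<dots> = (\<integral>\<^sup>+x. occ n x \<partial>count_space W)"
    by (rule nn_integral_count_space_indicator[symmetric]) simp
  finally show ?thesis by (simp add: occ_total)
qed

lemma letter_mass_1:
  assumes j: "j \<in> {1..r}"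
  shows "letter_mass j 1 = \<alpha> j"
proof -
  have "return_mass j 0 = 0" by (simp add: return_mass_eq[OF j])
  then show ?thesis using letter_mass_Suc[OF j, of 0] by (simp add: letter_mass_0)
qed

lemma gf_block_length:
  "gf (\<lambda>n. \<integral>\<^sup>+x. occ n x * h (length x) \<partial>count_space W) z =
    green z * (h 0 + (\<Sum>j=1..r. block_sum j h z))"
proof -
  have "gf (\<lambda>n. \<integral>\<^sup>+x. occ n x * h (length x) \<partial>count_space W) z =
      (\<integral>\<^sup>+x. gf (\<lambda>n. h (length x) * occ n x) z \<partial>count_space W)"
    by (subst gf_nn_integral) (simp_all add: mult.commute)
  also have "\<dots> = (\<integral>\<^sup>+x. green z * (weight z x * h (length x)) \<partial>count_space W)"
    by (simp add: gf_cmult gf_occ mult_ac)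
  also have "\<dots> = green z * (\<integral>\<^sup>+x. weight z x * h (length x) \<partial>count_space W)"
    by (simp add: nn_integral_cmult)
  finally show ?thesis unfolding sum_over_W block_sum_def by simp
qed

lemma green_ge_1: "1 \<le> green z"
  by (subst green_eqn) simp

section \<open>Finiteness of the letter weights beyond 1\<close>

text \<open>
  Real versions of the letter weights.  They carry information only at points where \<open>letter_gf\<close> is
  finite.
\<close>

definition L :: "nat \<Rightarrow> real \<Rightarrow> real" where
  "L j z = enn2real (letter_gf j (ennreal z))"

lemma L_nonneg: "0 \<le> L j z"
  by (simp add: L_def)

text \<open>
  If \<open>T\<close> is the sum over words \<open>x\<close> of \<open>weight z x * b ^ length x\<close> and \<open>T j\<close> the part of the words that
  start in \<open>V j\<close>, then \<open>T j = b L j z (T - T j)\<close>, so that \<open>T j = T * (b L j z / (1 + b L j z))\<close> and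
  \<open>T (1 - \<Phi> z b) = 1\<close>.  The value \<open>1\<close> of \<open>\<Phi>\<close> is thus the threshold for the finiteness of \<open>T\<close>.
\<close>

definition \<Phi> :: "real \<Rightarrow> real \<Rightarrow> real" where
  "\<Phi> z b = (\<Sum>j=1..r. b * L j z / (1 + b * L j z))"

lemma letter_gf_L: "letter_gf j (ennreal z) \<noteq> \<top> \<Longrightarrow> letter_gf j (ennreal z) = ennreal (L j z)"
  by (simp add: L_def less_top)

lemma letter_gf_finite_inside:
  assumes "j \<in> {1..r}" "0 \<le> z" "z < 1"
  shows "letter_gf j (ennreal z) \<noteq> \<top>"
proof -
  have "letter_gf j (ennreal z) \<le> gf (\<lambda>n. 1) (ennreal z)"
    unfolding letter_gf_def using letter_mass_le_1[OF assms(1)] by (intro gf_mono) auto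
  then show ?thesis using gf_one[OF assms(2,3)] by (auto simp: top_unique)
qed

text \<open>
  For \<open>z < 1\<close> the total weight of all words is at most \<open>1 / (1 - z)\<close>, hence finite, and the linear
  system for the sums over words by first letter can be solved.
\<close>

lemma \<Phi>_inside:
  assumes z: "0 < z" "z < 1"
  shows "\<Phi> z 1 < 1"
proof -
  let ?T = "\<lambda>j. block_sum j (\<lambda>n. 1) (ennreal z)"
  define t where "t j = enn2real (?T j)" for j
  define S where "S = 1 + (\<Sum>i=1..r. t i)"
  have "1 + (\<Sum>j=1..r. ?T j) \<le> green z * (1 + (\<Sum>j=1..r. ?T j))"
    using mult_right_mono[OF green_ge_1, of "1 + (\<Sum>j=1..r. ?T j)"] by simp
  also have "\<dots> = ennreal (1 / (1 - z))"
    using gf_block_length[of "\<lambda>n. 1" "ennreal z"] gf_one[of z] z by (simp add: occ_total)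
  also have "\<dots> < \<top>" by simp
  finally have "?T j \<noteq> \<top>" if "j \<in> {1..r}" for j
    using that by (auto simp: ennreal_sum_less_top less_top)
  then have T: "?T j = ennreal (t j)" if "j \<in> {1..r}" for j
    using that by (simp add: t_def less_top)
  have t0: "0 \<le> t j" for j by (simp add: t_def)
  have S: "1 \<le> S" unfolding S_def using t0 by (simp add: sum_nonneg)
  have "t j = S * (L j z / (1 + L j z))" if j: "j \<in> {1..r}" for j
  proof -
    have "ennreal (t j) = ennreal (L j z) * (1 + (\<Sum>i\<in>{1..r} - {j}. ennreal (t i)))"
      unfolding T[OF j, symmetric] letter_gf_L[OF letter_gf_finite_inside[OF j less_imp_le[OF z(1)] z(2)], symmetric]
      using block_sum_rec[OF j, of "\<lambda>n. 1" "ennreal z"] T by simp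
    also have "\<dots> = ennreal (L j z * (1 + (\<Sum>i\<in>{1..r} - {j}. t i)))"
      by (simp add: sum_ennreal t0 sum_nonneg L_nonneg ennreal_mult ennreal_plus[symmetric] ennreal_1[symmetric]
          del: ennreal_plus ennreal_1)
    finally have "t j = L j z * (1 + (\<Sum>i\<in>{1..r} - {j}. t i))"
      using t0 L_nonneg by (simp add: sum_nonneg)
    also have "(\<Sum>i\<in>{1..r} - {j}. t i) = (\<Sum>i=1..r. t i) - t j"
      using j by (simp add: sum_diff1)
    finally have "t j * (1 + L j z) = S * L j z" by (simp add: S_def algebra_simps)
    moreover have "1 + L j z > 0" using L_nonneg[of j z] by linarith
    ultimately show ?thesis by (simp add: field_simps)
  qed
  then have "S = 1 + S * \<Phi> z 1"
    unfolding \<Phi>_def sum_distrib_left by (subst S_def) simp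
  then have "S * (1 - \<Phi> z 1) = 1" by (simp add: algebra_simps)
  with S have "1 - \<Phi> z 1 > 0" by (metis less_le_trans zero_less_mult_pos zero_less_one)
  then show ?thesis by simp
qed

lemma L_ge:
  assumes j: "j \<in> {1..r}" and z: "0 \<le> z" and fin: "letter_gf j (ennreal z) \<noteq> \<top>"
  shows "\<alpha> j * z \<le> L j z"
proof -
  have "ennreal (\<alpha> j * z) = letter_mass j 1 * ennreal z ^ 1"
    using z \<alpha>_pos[OF j] letter_mass_1[OF j] by (simp add: ennreal_mult)
  also have "\<dots> = (\<Sum>n\<in>{1}. letter_mass j n * ennreal z ^ n)" by simp
  also have "\<dots> \<le> letter_gf j (ennreal z)"
    unfolding letter_gf_def gf_def by (rule sum_le_suminf) auto
  finally show ?thesis using letter_gf_L[OF fin] L_nonneg by simp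
qed

text \<open>
  Two summands of \<open>\<Phi> z 1\<close> already add up to less than \<open>1\<close>.
\<close>

lemma L_mult_le_1:
  assumes ij: "i \<in> {1..r}" "j \<in> {1..r}" "i \<noteq> j" and z: "0 < z" "z < 1"
  shows "L i z * L j z \<le> 1"
proof -
  define f where "f = (\<lambda>j. 1 * L j z / (1 + 1 * L j z))"
  have "sum f {i, j} \<le> sum f {1..r}"
    using ij L_nonneg by (intro sum_mono2) (auto simp: f_def)
  also have "\<dots> < 1" using \<Phi>_inside[OF z] by (simp add: \<Phi>_def f_def)
  finally have "L i z / (1 + L i z) + L j z / (1 + L j z) < 1" using ij(3) by (simp add: f_def)
  moreover have pos: "1 + L i z > 0" "1 + L j z > 0" using L_nonneg[of i z] L_nonneg[of j z] by linarith+
  moreover from this have "1 - L j z / (1 + L j z) = 1 / (1 + L j z)"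
    by (simp add: field_simps)
  ultimately have "L i z / (1 + L i z) < 1 / (1 + L j z)" by linarith
  with pos have "L i z * (1 + L j z) < 1 + L i z" by (simp add: field_simps)
  then show ?thesis by (simp add: algebra_simps)
qed

text \<open>
  There is a second factor \<open>i\<close>, and \<open>L i\<close> is bounded away from \<open>0\<close> near \<open>1\<close>; so the product bound
  keeps \<open>L j\<close> bounded as \<open>z\<close> increases to \<open>1\<close>.
\<close>

lemma letter_gf_finite_at_1:
  assumes j: "j \<in> {1..r}"
  shows "letter_gf j 1 \<noteq> \<top>"
proof -
  obtain i where i: "i \<in> {1..r}" "i \<noteq> j"
    using r_ge_2 by (metis Suc_1 atLeastAtMost_iff le_trans one_le_numeral order_refl n_not_Suc_n One_nat_def)
  define C where "C = 2 / \<alpha> i"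
  have \<alpha>: "\<alpha> i > 0" using \<alpha>_pos i by simp
  have bound: "L j z \<le> C" if z: "1 / 2 < z" "z < 1" for z
  proof -
    have "\<alpha> i * (1/2) * L j z \<le> \<alpha> i * z * L j z"
      using \<alpha> z L_nonneg by (intro mult_right_mono mult_left_mono) auto
    also have "\<dots> \<le> L i z * L j z"
      using L_ge[OF i(1) _ letter_gf_finite_inside[OF i(1)], of z] z L_nonneg by (intro mult_right_mono) auto
    also have "\<dots> \<le> 1" using L_mult_le_1[OF i(1) j i(2)] z by simp
    finally show ?thesis using \<alpha> by (simp add: C_def field_simps)
  qed
  define c where "c n = enn2real (letter_mass j n)" for n
  have lm: "letter_mass j n = ennreal (c n)" for n
    using le_less_trans[OF letter_mass_le_1[OF j, of n] ennreal_one_less_top] by (simp add: c_def)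
  have "(\<Sum>n<N. c n) \<le> C" for N
  proof -
    have "((\<lambda>z. \<Sum>n<N. c n * z ^ n) \<longlongrightarrow> (\<Sum>n<N. c n * 1 ^ n)) (at_left 1)"
      by (intro tendsto_intros)
    moreover have "eventually (\<lambda>z. (\<Sum>n<N. c n * z ^ n) \<le> C) (at_left (1::real))"
    proof -
      have "eventually (\<lambda>z. z \<in> {1/2<..<1}) (at_left (1::real))"
        by (rule eventually_at_left_real) simp
      then show ?thesis
      proof eventually_elim
        case (elim z)
        have "ennreal (\<Sum>n<N. c n * z ^ n) = (\<Sum>n<N. letter_mass j n * ennreal z ^ n)"
          unfolding lm using elim by (subst sum_ennreal[symmetric]) (auto simp: c_def ennreal_mult ennreal_power)
        also have "\<dots> \<le> letter_gf j (ennreal z)"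
          unfolding letter_gf_def gf_def by (rule sum_le_suminf) auto
        also have "\<dots> = ennreal (L j z)"
          using elim by (intro letter_gf_L letter_gf_finite_inside[OF j]) auto
        finally have "(\<Sum>n<N. c n * z ^ n) \<le> L j z" using L_nonneg by simp
        also have "\<dots> \<le> C" using bound elim by simp
        finally show ?case .
      qed
    qed
    ultimately show ?thesis
      using tendsto_upperbound[of "\<lambda>z. \<Sum>n<N. c n * z ^ n" _ "at_left (1::real)" C] by simp
  qed
  then have "letter_gf j 1 \<le> ennreal C"
    unfolding letter_gf_def gf_def lm
    by (intro suminf_le_const) (auto simp: sum_ennreal c_def intro!: ennreal_leI)
  then show ?thesis by (auto simp: top_unique)
qed

text \<open>
  Transience: by the renewal equation, a total first return weight of at least \<open>1\<close> would make
  \<open>green z\<close> exceed itself by \<open>1\<close>.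
\<close>

lemma return_gf_sum_lt_1:
  assumes "green z \<noteq> \<top>"
  shows "(\<Sum>j=1..r. return_gf j z) < 1"
proof (rule ccontr)
  assume "\<not> ?thesis"
  then have "1 \<le> (\<Sum>j=1..r. return_gf j z)" by simp
  then have "green z * 1 \<le> green z * (\<Sum>j=1..r. return_gf j z)" by (rule mult_left_mono) simp
  then have "1 + green z \<le> green z"
    using green_eqn[of z] by (metis add_left_mono mult.right_neutral)
  with assms show False
    by (cases "green z") (auto simp: ennreal_plus[symmetric] ennreal_1[symmetric] simp del: ennreal_plus ennreal_1)
qed

text \<open>
  First returns to the empty word through a factor different from \<open>j\<close>.  By self-similarity these are
  also the excursions from a letter of \<open>V j\<close> back to it.
\<close>

definition others :: "nat \<Rightarrow> real \<Rightarrow> real" where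
  "others j z = (\<Sum>k\<in>{1..r} - {j}. enn2real (return_gf k (ennreal z)))"

lemma return_gf_finite:
  assumes "green z \<noteq> \<top>" "k \<in> {1..r}"
  shows "return_gf k z \<noteq> \<top>"
proof -
  have "(\<Sum>j=1..r. return_gf j z) < \<top>" using return_gf_sum_lt_1[OF assms(1)] by (rule less_trans) simp
  then show ?thesis using assms(2) by (auto simp: less_top)
qed

lemma others_eq:
  assumes "green (ennreal z) \<noteq> \<top>"
  shows "(\<Sum>k\<in>{1..r} - {j}. return_gf k (ennreal z)) = ennreal (others j z)"
proof -
  have "(\<Sum>k\<in>{1..r} - {j}. return_gf k (ennreal z)) =
      (\<Sum>k\<in>{1..r} - {j}. ennreal (enn2real (return_gf k (ennreal z))))"
    using return_gf_finite[OF assms] by (intro sum.cong) (auto simp: less_top)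
  then show ?thesis by (simp add: others_def sum_ennreal)
qed

text \<open>
  The balance equation says \<open>l * (1 - \<alpha> j - others j 1) = \<alpha> j - R\<close>, with \<open>R\<close> the probability of a first
  return through \<open>V j\<close>.  If the left-hand side were not positive, returns through \<open>V j\<close> would have
  probability at least \<open>\<alpha> j\<close>, and then returns altogether would have probability at least
  \<open>\<alpha> j + others j 1 \<ge> 1\<close>, contradicting transience.
\<close>

lemma others_at_1:
  assumes green: "green 1 \<noteq> \<top>" and j: "j \<in> {1..r}"
  shows "\<alpha> j + others j 1 < 1"
proof (rule ccontr)
  assume "\<not> ?thesis"
  then have ge: "1 \<le> \<alpha> j + others j 1" by simp
  define R where "R = enn2real (return_gf j 1)"
  define l where "l = L j 1"
  have \<alpha>: "0 < \<alpha> j" using \<alpha>_pos[OF j] .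
  have others0: "0 \<le> others j 1" by (simp add: others_def sum_nonneg)
  have Req: "return_gf j 1 = ennreal R" using return_gf_finite[OF green j] by (simp add: R_def less_top)
  have leq: "letter_gf j 1 = ennreal l"
    using letter_gf_L[of j 1] letter_gf_finite_at_1[OF j] by (simp add: l_def)
  have R0: "0 \<le> R" "0 \<le> l" by (simp_all add: R_def l_def L_nonneg)
  have "(\<Sum>k=1..r. return_gf k 1) = return_gf j 1 + (\<Sum>k\<in>{1..r} - {j}. return_gf k 1)"
    using j by (intro sum.remove) auto
  also have "\<dots> = ennreal (R + others j 1)"
    using others_eq[of 1 j] green Req R0 others0 by simp
  finally have "ennreal (R + others j 1) < ennreal 1"
    using return_gf_sum_lt_1[OF green] by (simp only: ennreal_1)
  then have lt: "R + others j 1 < 1"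
    using R0 others0 by (subst (asm) ennreal_less_iff) auto
  have "ennreal (l + R) = ennreal (\<alpha> j * (1 + l) + l * others j 1)"
    using letter_gf_eqn[OF j, of 1] others_eq[of 1 j] green Req leq R0 others0 \<alpha>
    by (simp add: ennreal_mult)
  then have "l + R = \<alpha> j * (1 + l) + l * others j 1"
    using R0 others0 \<alpha> by (subst (asm) ennreal_inj) (auto intro!: add_nonneg_nonneg mult_nonneg_nonneg)
  then have "l * (\<alpha> j + others j 1) + \<alpha> j = l + R" by (simp add: algebra_simps)
  moreover have "l * 1 \<le> l * (\<alpha> j + others j 1)" using ge R0 by (intro mult_left_mono) auto
  ultimately have "\<alpha> j \<le> R" by simp
  with ge lt show False by simp
qed

text \<open>
  Solving the balance equation for \<open>letter_gf\<close> would give the bound \<open>C\<close> below, but only if finiteness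
  were known.  Therefore the equation is applied, as an inequality, to the series truncated at \<open>N\<close>,
  where it propagates the bound from \<open>N\<close> to \<open>N + 1\<close>.
\<close>

lemma letter_gf_bound:
  assumes j: "j \<in> {1..r}" and z: "0 \<le> z" and green: "green (ennreal z) \<noteq> \<top>"
    and lt: "z * \<alpha> j + others j z < 1"
  shows "letter_gf j (ennreal z) \<noteq> \<top>"
proof -
  define C where "C = z * \<alpha> j / (1 - z * \<alpha> j - others j z)"
  define a where "a N n = (if n \<le> N then letter_mass j n else 0)" for N n :: nat
  have \<alpha>: "0 < \<alpha> j" using \<alpha>_pos[OF j] .
  have others0: "0 \<le> others j z" by (simp add: others_def sum_nonneg)
  have C0: "0 \<le> C" using lt z \<alpha> by (auto simp: C_def intro!: divide_nonneg_nonneg)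
  have "C * (1 - z * \<alpha> j - others j z) = z * \<alpha> j"
    using lt by (simp add: C_def)
  then have Ceq: "z * \<alpha> j * (1 + C) + C * others j z = C"
    by (simp add: algebra_simps)
  have one: "gf (\<lambda>n. if n = 0 then 1 else 0) x = 1" for x
    using weight_Nil by (simp add: weight_def taboo_Nil)
  \<comment> \<open>Truncation keeps both the balance inequality and the convolution structure.\<close>
  have "gf (a N) (ennreal z) \<le> ennreal C" for N
  proof (induction N)
    case 0
    have "a 0 n = 0" for n by (simp add: a_def letter_mass_0)
    then show ?case by (simp add: gf_def)
  next
    case (Suc N)
    have "a (Suc N) (Suc n) \<le> \<alpha> j * ((if n = 0 then 1 else 0) + a N n) +
      (\<Sum>m\<le>n. a N m * (\<Sum>k\<in>{1..r} - {j}. return_mass k (n - m)))" for n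
    proof (cases "n \<le> N")
      case True
      have "a (Suc N) (Suc n) \<le> letter_mass j (Suc n) + return_mass j n" using True by (simp add: a_def)
      also have "\<dots> = \<alpha> j * ((if n = 0 then 1 else 0) + a N n) +
          (\<Sum>m\<le>n. a N m * (\<Sum>k\<in>{1..r} - {j}. return_mass k (n - m)))"
        unfolding letter_mass_Suc[OF j] using True by (simp add: a_def del: One_nat_def)
      finally show ?thesis .
    qed (simp add: a_def)
    then have "gf (\<lambda>n. a (Suc N) (Suc n)) (ennreal z) \<le>
        gf (\<lambda>n. \<alpha> j * ((if n = 0 then 1 else 0) + a N n) +
          (\<Sum>m\<le>n. a N m * (\<Sum>k\<in>{1..r} - {j}. return_mass k (n - m)))) (ennreal z)"
      by (intro gf_mono) auto
    also have "\<dots> = \<alpha> j * (1 + gf (a N) (ennreal z)) +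
        gf (a N) (ennreal z) * (\<Sum>k\<in>{1..r} - {j}. gf (return_mass k) (ennreal z))"
      using gf_convolution[of "a N" "\<lambda>n. \<Sum>k\<in>{1..r} - {j}. return_mass k n" "ennreal z"]
      by (simp add: gf_add gf_cmult gf_sum one)
    finally have "z * gf (\<lambda>n. a (Suc N) (Suc n)) (ennreal z) \<le> z * (\<alpha> j * (1 + gf (a N) (ennreal z)) +
        gf (a N) (ennreal z) * (\<Sum>k\<in>{1..r} - {j}. gf (return_mass k) (ennreal z)))"
      by (rule mult_left_mono) simp
    also have "\<dots> = z * \<alpha> j * (1 + gf (a N) (ennreal z)) +
        gf (a N) (ennreal z) * (\<Sum>k\<in>{1..r} - {j}. return_gf k (ennreal z))"
      using z unfolding return_gf_def
      by (simp add: distrib_left sum_distrib_left mult_ac ennreal_mult')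
    also have "\<dots> \<le> z * \<alpha> j * (1 + ennreal C) + ennreal C * ennreal (others j z)"
      unfolding others_eq[OF green] using Suc.IH by (intro add_mono mult_mono) auto
    also have "\<dots> = ennreal (z * \<alpha> j * (1 + C) + C * others j z)"
      using z \<alpha> C0 others0
      by (simp add: ennreal_mult)
    finally have "z * gf (\<lambda>n. a (Suc N) (Suc n)) (ennreal z) \<le> ennreal C" by (simp add: Ceq)
    then show ?case by (subst gf_Suc) (simp add: a_def letter_mass_0)
  qed
  have "letter_gf j (ennreal z) \<le> ennreal C"
    unfolding letter_gf_def gf_def
  proof (rule suminf_le_const)
    fix N
    have "(\<Sum>n<N. letter_mass j n * ennreal z ^ n) = (\<Sum>n<N. a N n * ennreal z ^ n)"
      by (intro sum.cong) (auto simp: a_def)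
    also have "\<dots> \<le> gf (a N) (ennreal z)"
      unfolding gf_def by (rule sum_le_suminf) auto
    finally show "(\<Sum>n<N. letter_mass j n * ennreal z ^ n) \<le> ennreal C"
      using \<open>gf (a N) (ennreal z) \<le> ennreal C\<close> by simp
  qed simp
  then show ?thesis by (auto simp: top_unique)
qed

text \<open>
  Finitely many strict inequalities between functions continuous at \<open>1\<close> extend from \<open>1\<close> to some
  larger point.
\<close>

lemma letter_gf_finite_beyond_1:
  assumes z0: "1 < z0" and green: "green (ennreal z0) \<noteq> \<top>"
  obtains z1 where "1 < z1" "z1 \<le> z0" "\<forall>j\<in>{1..r}. letter_gf j (ennreal z1) \<noteq> \<top>"
proof -
  have green_le: "green (ennreal z) \<noteq> \<top>" if "z \<le> z0" for z
  proof -
    have "green (ennreal z) \<le> green (ennreal z0)"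
      unfolding green_def using that by (intro gf_mono) (auto intro: ennreal_leI)
    with green show ?thesis by (auto simp: top_unique)
  qed
  have "isCont (others j) 1" for j
  proof -
    have "isCont (\<lambda>z. enn2real (return_gf k (ennreal z))) 1" if k: "k \<in> {1..r}" for k
    proof -
      have fin: "gf (return_mass k) (ennreal z0) \<noteq> \<top>"
        using return_gf_finite[OF green k] z0 by (auto simp: return_gf_def ennreal_mult_top)
      obtain d where "((\<lambda>x. enn2real (gf (return_mass k) (ennreal x))) has_real_derivative d) (at 1)"
        using gf_has_derivative[OF fin, of 1] z0 by auto
      then have "isCont (\<lambda>x. x * enn2real (gf (return_mass k) (ennreal x))) 1"
        by (intro continuous_mult) (auto intro: DERIV_isCont)
      moreover have "eventually (\<lambda>x. x * enn2real (gf (return_mass k) (ennreal x)) =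
          enn2real (return_gf k (ennreal x))) (nhds (1::real))"
        using eventually_nhds_in_open[of "{0<..}" "1::real"]
        by (auto elim!: eventually_mono simp: return_gf_def enn2real_mult)
      ultimately show ?thesis by (simp add: isCont_cong)
    qed
    then show ?thesis unfolding others_def by (intro continuous_sum) auto
  qed
  then have "((\<lambda>z. z * \<alpha> j + others j z) \<longlongrightarrow> 1 * \<alpha> j + others j 1) (at_right 1)" for j
    by (intro tendsto_intros) (auto simp: isCont_def filterlim_at_split)
  then have "eventually (\<lambda>z. z * \<alpha> j + others j z < 1) (at_right 1)" if "j \<in> {1..r}" for j
    by (rule order_tendstoD(2)) (use others_at_1[OF _ that] green_le[of 1] z0 in auto)
  then have "eventually (\<lambda>z. \<forall>j\<in>{1..r}. z * \<alpha> j + others j z < 1) (at_right 1)"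
    by (intro eventually_ball_finite) auto
  moreover have "eventually (\<lambda>z. z \<in> {1<..<z0}) (at_right 1)"
    by (rule eventually_at_right_real) (rule z0)
  ultimately have "eventually (\<lambda>z. z \<in> {1<..<z0} \<and> (\<forall>j\<in>{1..r}. z * \<alpha> j + others j z < 1)) (at_right 1)"
    by eventually_elim simp
  then obtain z1 where z1: "z1 \<in> {1<..<z0}" "\<forall>j\<in>{1..r}. z1 * \<alpha> j + others j z1 < 1"
    using eventually_happens[of _ "at_right (1::real)"] by (auto simp: trivial_limit_at_right_real)
  show thesis
  proof (rule that[of z1])
    show "\<forall>j\<in>{1..r}. letter_gf j (ennreal z1) \<noteq> \<top>"
    proof
      fix j assume j: "j \<in> {1..r}"
      then show "letter_gf j (ennreal z1) \<noteq> \<top>"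
        using letter_gf_bound[OF j _ green_le[of z1]] z1 by force
    qed
  qed (use z1 in auto)
qed

section \<open>Exponential moments of the block length\<close>

lemma \<Phi>_summand_nonneg: "0 \<le> b \<Longrightarrow> 0 \<le> b * L j z / (1 + b * L j z)"
  by (simp add: L_nonneg)

lemma block_sum_cmult: "block_sum j (\<lambda>n. c * h n) z = c * block_sum j h z"
  unfolding block_sum_def by (simp add: mult.left_commute nn_integral_cmult)

text \<open>
  Words of length at most \<open>K\<close> are treated by induction on \<open>K\<close>.  The bounds \<open>C * \<phi> j\<close> solve the linear
  system satisfied by the untruncated sums, so the recursion reproduces them exactly.
\<close>

lemma block_sum_bound:
  assumes fin: "\<And>j. j \<in> {1..r} \<Longrightarrow> letter_gf j (ennreal z) \<noteq> \<top>"
    and b: "0 < b" and lt: "\<Phi> z b < 1" and j: "j \<in> {1..r}"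
  shows "block_sum j (\<lambda>n. ennreal b ^ n) (ennreal z) \<noteq> \<top>"
proof -
  define C where "C = 1 / (1 - \<Phi> z b)"
  define \<phi> where "\<phi> j = b * L j z / (1 + b * L j z)" for j
  define h where "h K n = (if n \<le> K then ennreal b ^ n else 0)" for K n
  have C0: "0 \<le> C" using lt by (simp add: C_def)
  have C: "1 + C * \<Phi> z b = C" using lt by (simp add: C_def field_simps)
  have \<phi>0: "0 \<le> \<phi> j" for j using \<Phi>_summand_nonneg b by (simp add: \<phi>_def)
  have bound: "block_sum j (h K) (ennreal z) \<le> ennreal (C * \<phi> j)" if "j \<in> {1..r}" for j K
    using that
  proof (induction K arbitrary: j)
    case 0
    have "block_sum j (h 0) (ennreal z) = (\<integral>\<^sup>+x. 0 \<partial>count_space (starting j))"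
      unfolding block_sum_def by (intro nn_integral_cong) (auto simp: h_def starting_def)
    then show ?case by simp
  next
    case (Suc K)
    have pos: "1 + b * L j z > 0" using b L_nonneg[of j z] by (simp add: add_pos_nonneg)
    have "(\<lambda>n. h (Suc K) (Suc n)) = (\<lambda>n. ennreal b * h K n)" "h (Suc K) 1 = ennreal b"
      by (auto simp: h_def)
    then have "block_sum j (h (Suc K)) (ennreal z) = ennreal (L j z) *
        (ennreal b + (\<Sum>i\<in>{1..r} - {j}. ennreal b * block_sum i (h K) (ennreal z)))"
      using block_sum_rec[OF Suc.prems, of "h (Suc K)" "ennreal z"] letter_gf_L[OF fin[OF Suc.prems]]
      by (simp add: block_sum_cmult)
    also have "\<dots> \<le> ennreal (L j z) * (ennreal b + (\<Sum>i\<in>{1..r} - {j}. ennreal b * ennreal (C * \<phi> i)))"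
      by (intro mult_left_mono add_left_mono sum_mono Suc.IH) auto
    also have "\<dots> = ennreal (L j z * (b + (\<Sum>i\<in>{1..r} - {j}. b * (C * \<phi> i))))"
    proof -
      have "(\<Sum>i\<in>{1..r} - {j}. ennreal b * ennreal (C * \<phi> i)) = (\<Sum>i\<in>{1..r} - {j}. ennreal (b * (C * \<phi> i)))"
        using b C0 \<phi>0 by (intro sum.cong) (auto simp: ennreal_mult)
      also have "\<dots> = ennreal (\<Sum>i\<in>{1..r} - {j}. b * (C * \<phi> i))"
        using b C0 \<phi>0 by (intro sum_ennreal) auto
      finally show ?thesis
        using b C0 \<phi>0 L_nonneg by (simp add: ennreal_mult sum_nonneg add_nonneg_nonneg)
    qed
    also have "L j z * (b + (\<Sum>i\<in>{1..r} - {j}. b * (C * \<phi> i))) = b * L j z * (1 + C * (\<Phi> z b - \<phi> j))"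
    proof -
      have "(\<Sum>i\<in>{1..r} - {j}. \<phi> i) = \<Phi> z b - \<phi> j"
        using Suc.prems by (simp add: \<Phi>_def \<phi>_def sum_diff1)
      then have "(\<Sum>i\<in>{1..r} - {j}. b * (C * \<phi> i)) = b * (C * (\<Phi> z b - \<phi> j))"
        by (simp only: sum_distrib_left[symmetric])
      then show ?thesis by (simp only:) (simp add: algebra_simps)
    qed
    also have "1 + C * (\<Phi> z b - \<phi> j) = C * (1 - \<phi> j)"
      using C by (simp add: algebra_simps)
    also have "b * L j z * (C * (1 - \<phi> j)) = C * \<phi> j"
    proof -
      have "b * L j z * (1 - \<phi> j) = \<phi> j"
        using pos by (simp add: \<phi>_def field_simps)
      then show ?thesis by (simp add: mult.left_commute)
    qed
    finally show ?case .
  qed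
  have "block_sum j (\<lambda>n. ennreal b ^ n) (ennreal z) =
      (\<integral>\<^sup>+x. (SUP K. weight (ennreal z) x * h K (length x)) \<partial>count_space (starting j))"
    unfolding block_sum_def
  proof (intro nn_integral_cong)
    fix x :: "'a list"
    have "(SUP K. h K (length x)) = ennreal b ^ length x"
      by (intro antisym SUP_least SUP_upper2[of "length x"]) (auto simp: h_def)
    then show "weight (ennreal z) x * ennreal b ^ length x = (SUP K. weight (ennreal z) x * h K (length x))"
      by (simp only: SUP_mult_left_ennreal[symmetric])
  qed
  also have "\<dots> = (SUP K. block_sum j (h K) (ennreal z))"
    unfolding block_sum_def
    by (rule nn_integral_monotone_convergence_SUP)
       (auto simp: incseq_def le_fun_def h_def intro!: mult_left_mono)
  also have "\<dots> \<le> ennreal (C * \<phi> j)"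
    by (intro SUP_least bound j)
  finally show ?thesis by (auto simp: top_unique)
qed

text \<open>
  The sum over \<open>n\<close> of \<open>z ^ n\<close> times the expectation of \<open>b ^ length (Z n)\<close>, factorised by the last visit
  to the empty word.
\<close>

lemma exponential_moment_finite:
  assumes fin: "\<And>j. j \<in> {1..r} \<Longrightarrow> letter_gf j (ennreal z) \<noteq> \<top>"
    and green: "green (ennreal z) \<noteq> \<top>" and b: "0 < b" and lt: "\<Phi> z b < 1"
  shows "gf (\<lambda>n. \<integral>\<^sup>+x. occ n x * ennreal b ^ length x \<partial>count_space W) (ennreal z) \<noteq> \<top>"
proof -
  have "(\<Sum>j=1..r. block_sum j (\<lambda>n. ennreal b ^ n) (ennreal z)) \<noteq> \<top>"
    using block_sum_bound[OF fin b lt] by simp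
  then show ?thesis
    unfolding gf_block_length using green by (auto simp: ennreal_mult_eq_top_iff)
qed

text \<open>
  A single vector \<open>d\<close> of derivatives of the \<open>L j\<close> at \<open>1\<close> serves all directions \<open>c\<close>.
\<close>

lemma \<Phi>_has_derivative:
  assumes z1: "1 < z1" and fin: "\<forall>j\<in>{1..r}. letter_gf j (ennreal z1) \<noteq> \<top>"
  obtains d where "\<forall>j\<in>{1..r}. \<alpha> j \<le> d j"
    "\<forall>c. ((\<lambda>s. \<Phi> (exp s) (exp (- s * c))) has_real_derivative
      (\<Sum>j=1..r. (d j - c * L j 1) / (1 + L j 1)\<^sup>2)) (at 0)"
proof -
  have "\<exists>d. \<alpha> j \<le> d \<and> (L j has_real_derivative d) (at 1)" if j: "j \<in> {1..r}" for j
  proof -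
    obtain d where "enn2real (letter_mass j 1) \<le> d"
      "((\<lambda>x. enn2real (gf (letter_mass j) (ennreal x))) has_real_derivative d) (at 1)"
      using gf_has_derivative[of "letter_mass j" z1 1] fin j z1 by (auto simp: letter_gf_def)
    moreover have "enn2real (letter_mass j 1) = \<alpha> j"
      using letter_mass_1[OF j] \<alpha>_pos[OF j] by simp
    moreover have "L j = (\<lambda>x. enn2real (gf (letter_mass j) (ennreal x)))"
      by (simp add: fun_eq_iff L_def letter_gf_def)
    ultimately show ?thesis by auto
  qed
  then obtain d where d: "\<And>j. j \<in> {1..r} \<Longrightarrow> \<alpha> j \<le> d j"
      "\<And>j. j \<in> {1..r} \<Longrightarrow> (L j has_real_derivative d j) (at 1)"
    by metis
  have "((\<lambda>s. \<Phi> (exp s) (exp (- s * c))) has_real_derivative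
      (\<Sum>j=1..r. (d j - c * L j 1) / (1 + L j 1)\<^sup>2)) (at 0)" for c
    unfolding \<Phi>_def
  proof (rule DERIV_sum)
    fix j assume j: "j \<in> {1..r}"
    have "((\<lambda>s. L j (exp s)) has_real_derivative d j * exp 0) (at 0)"
      by (rule DERIV_chain2[where f = "L j"]) (use d(2)[OF j] in \<open>auto intro!: derivative_eq_intros\<close>)
    then have f: "((\<lambda>s. exp (- s * c) * L j (exp s)) has_real_derivative (d j - c * L j 1)) (at 0)"
      by (auto intro!: derivative_eq_intros)
    have nz: "1 + L j 1 \<noteq> 0" using L_nonneg[of j 1] by linarith
    have "((\<lambda>s. exp (- s * c) * L j (exp s) / (1 + exp (- s * c) * L j (exp s))) has_real_derivative
        ((d j - c * L j 1) * (1 + exp (- 0 * c) * L j (exp 0)) -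
          (exp (- 0 * c) * L j (exp 0)) * (0 + (d j - c * L j 1))) /
        ((1 + exp (- 0 * c) * L j (exp 0)) * (1 + exp (- 0 * c) * L j (exp 0)))) (at 0)"
      by (rule DERIV_divide[OF f DERIV_add[OF DERIV_const f]]) (use nz in simp)
    then show "((\<lambda>s. exp (- s * c) * L j (exp s) / (1 + exp (- s * c) * L j (exp s)))
        has_real_derivative (d j - c * L j 1) / (1 + L j 1)\<^sup>2) (at 0)"
      by (simp add: power2_eq_square algebra_simps)
  qed
  moreover have "\<forall>j\<in>{1..r}. \<alpha> j \<le> d j" using d(1) by blast
  ultimately show thesis using that by blast
qed

text \<open>
  The upper bound is the limit of \<open>\<Phi>_inside\<close>.  For the lower bound, \<open>\<Phi> 1 1 < 1\<close> would make the sum over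
  all \<open>n\<close> of the total mass \<open>1\<close> finite.
\<close>

lemma \<Phi>_at_1:
  assumes z1: "1 < z1" and fin: "\<forall>j\<in>{1..r}. letter_gf j (ennreal z1) \<noteq> \<top>"
    and green: "green (ennreal 1) \<noteq> \<top>"
  shows "\<Phi> 1 1 = 1"
proof (rule antisym)
  obtain d where D: "\<forall>c. ((\<lambda>s. \<Phi> (exp s) (exp (- s * c))) has_real_derivative
      (\<Sum>j=1..r. (d j - c * L j 1) / (1 + L j 1)\<^sup>2)) (at 0)"
    using \<Phi>_has_derivative[OF z1 fin] by blast
  from DERIV_isCont[OF D[THEN spec, of 0]] have "((\<lambda>s. \<Phi> (exp s) 1) \<longlongrightarrow> \<Phi> 1 1) (at_left 0)"
    by (simp add: isCont_def filterlim_at_split)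
  moreover have "eventually (\<lambda>s. \<Phi> (exp s) 1 \<le> 1) (at_left (0::real))"
    unfolding eventually_at_filter using \<Phi>_inside by (intro always_eventually) (auto intro: less_imp_le)
  ultimately show "\<Phi> 1 1 \<le> 1"
    by (rule tendsto_upperbound) simp
next
  show "1 \<le> \<Phi> 1 1"
  proof (rule ccontr)
    assume "\<not> 1 \<le> \<Phi> 1 1"
    then have "gf (\<lambda>n. \<integral>\<^sup>+x. occ n x * ennreal 1 ^ length x \<partial>count_space W) (ennreal 1) \<noteq> \<top>"
      using letter_gf_finite_at_1 green by (intro exponential_moment_finite) auto
    then show False using gf_one_ge_1[of 1] by (simp add: occ_total)
  qed
qed

text \<open>
  The sum over \<open>n\<close> of the expectations of \<open>exp (s * (n - c * length (Z n)))\<close>.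
\<close>

definition moment_gf :: "real \<Rightarrow> real \<Rightarrow> ennreal" where
  "moment_gf s c =
    gf (\<lambda>n. \<integral>\<^sup>+x. occ n x * ennreal (exp (- s * c)) ^ length x \<partial>count_space W) (exp s)"

text \<open>
  Starting from the critical value \<open>\<Phi> 1 1 = 1\<close>, one moves in the direction in which
  \<open>s \<mapsto> \<Phi> (exp s) (exp (- s c))\<close> decreases; its slope \<open>N - c M\<close> at \<open>0\<close> changes sign at \<open>c = N / M\<close>.
\<close>

lemma speed_exists:
  assumes z0: "1 < z0" and green: "green (ennreal z0) \<noteq> \<top>"
  shows "\<exists>\<Lambda>>0. (\<forall>c>\<Lambda>. \<exists>s>0. moment_gf s c \<noteq> \<top>) \<and>
    (\<forall>c<\<Lambda>. \<exists>s<0. moment_gf s c \<noteq> \<top>)"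
proof -
  obtain z1 where z1: "1 < z1" "z1 \<le> z0" and fin: "\<forall>j\<in>{1..r}. letter_gf j (ennreal z1) \<noteq> \<top>"
    using letter_gf_finite_beyond_1[OF z0 green] by blast
  have green_le: "green (ennreal z) \<noteq> \<top>" if "z \<le> z1" for z
  proof -
    have "green (ennreal z) \<le> green (ennreal z0)"
      unfolding green_def using that z1 by (intro gf_mono) (auto intro: ennreal_leI)
    with green show ?thesis by (auto simp: top_unique)
  qed
  have fin_le: "letter_gf j (ennreal z) \<noteq> \<top>" if "z \<le> z1" "j \<in> {1..r}" for z j
  proof -
    have "letter_gf j (ennreal z) \<le> letter_gf j (ennreal z1)"
      unfolding letter_gf_def using that by (intro gf_mono) (auto intro: ennreal_leI)
    with fin that(2) show ?thesis by (auto simp: top_unique)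
  qed
  have moment: "moment_gf s c \<noteq> \<top>"
    if "exp s \<le> z1" "\<Phi> (exp s) (exp (- s * c)) < 1" for s c
    unfolding moment_gf_def by (rule exponential_moment_finite) (use that fin_le green_le in auto)
  have \<Phi>1: "\<Phi> 1 1 = 1"
    using \<Phi>_at_1[OF z1(1) fin] green_le[of 1] z1 by simp
  obtain d where d: "\<forall>j\<in>{1..r}. \<alpha> j \<le> d j"
    and D: "\<forall>c. ((\<lambda>s. \<Phi> (exp s) (exp (- s * c))) has_real_derivative
      (\<Sum>j=1..r. (d j - c * L j 1) / (1 + L j 1)\<^sup>2)) (at 0)"
    using \<Phi>_has_derivative[OF z1(1) fin] by blast
  define N where "N = (\<Sum>j=1..r. d j / (1 + L j 1)\<^sup>2)"
  define M where "M = (\<Sum>j=1..r. L j 1 / (1 + L j 1)\<^sup>2)"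
  have L1: "\<alpha> j \<le> L j 1" if "j \<in> {1..r}" for j
    using L_ge[OF that, of 1] letter_gf_finite_at_1[OF that] by simp
  have pos: "0 < (\<Sum>j=1..r. f j / (1 + L j 1)\<^sup>2)" if "\<And>j. j \<in> {1..r} \<Longrightarrow> \<alpha> j \<le> f j" for f
  proof (rule sum_pos)
    show "{1..r} \<noteq> {}" using r_ge_2 by simp
    fix j assume j: "j \<in> {1..r}"
    have "1 + L j 1 > 0" using L_nonneg[of j 1] by linarith
    moreover have "0 < f j" using \<alpha>_pos[OF j] that[OF j] by simp
    ultimately show "0 < f j / (1 + L j 1)\<^sup>2" by simp
  qed simp
  have NM: "0 < N" "0 < M"
    unfolding N_def M_def using pos[of d] d pos[of "\<lambda>j. L j 1", OF L1] by blast+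
  have D': "((\<lambda>s. \<Phi> (exp s) (exp (- s * c))) has_real_derivative N - c * M) (at 0)" for c
    using D[THEN spec, of c] by (simp add: N_def M_def diff_divide_distrib sum_subtractf sum_distrib_left)
  show ?thesis
  proof (rule exI[of _ "N / M"], intro conjI allI impI)
    show "0 < N / M" using NM by simp
  next
    fix c assume "N / M < c"
    then have "N - c * M < 0" using NM by (simp add: field_simps)
    from DERIV_neg_dec_right[OF D' this] obtain e where e: "0 < e"
      "\<And>h. 0 < h \<Longrightarrow> h < e \<Longrightarrow> \<Phi> (exp h) (exp (- h * c)) < 1"
      using \<Phi>1 by auto
    define s where "s = min (e / 2) (ln z1)"
    have s: "0 < s" "s < e" "s \<le> ln z1" using e(1) z1 by (auto simp: s_def min_def)
    then have "exp s \<le> z1" using z1 by (metis exp_le_cancel_iff exp_ln less_trans zero_less_one)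
    then show "\<exists>s>0. moment_gf s c \<noteq> \<top>"
      using moment[of s c] e(2)[OF s(1,2)] s(1) by blast
  next
    fix c assume "c < N / M"
    then have "N - c * M > 0" using NM by (simp add: field_simps)
    from DERIV_pos_inc_left[OF D' this] obtain e where e: "0 < e"
      "\<And>h. 0 < h \<Longrightarrow> h < e \<Longrightarrow> \<Phi> (exp (- h)) (exp (h * c)) < 1"
      using \<Phi>1 by auto
    have "exp (- (e / 2)) \<le> 1" using e(1) by simp
    with z1 have "exp (- (e / 2)) \<le> z1" by linarith
    then show "\<exists>s<0. moment_gf s c \<noteq> \<top>"
      using moment[of "- (e / 2)" c] e(2)[of "e / 2"] e(1) by (intro exI[of _ "- (e / 2)"]) simp
  qed
qed

lemma green_finite_beyond_1:
  assumes "conv_radius (\<lambda>n. n_step W P n [] []) > 1"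
  obtains z0 :: real where "1 < z0" "green (ennreal z0) \<noteq> \<top>"
proof -
  obtain z0 :: real where z0: "1 < ereal z0" "ereal z0 < conv_radius (\<lambda>n. n_step W P n [] [])"
    using ereal_dense2[OF assms] by blast
  then have z0': "1 < z0" by simp
  have "summable (\<lambda>n. n_step W P n [] [] * z0 ^ n)"
    using z0 z0' by (intro summable_in_conv_radius) auto
  then have "(\<Sum>n. ennreal (n_step W P n [] [] * z0 ^ n)) \<noteq> \<top>"
    using n_step_bounds(1) z0' by (intro ennreal_suminf_neq_top) auto
  moreover have "green (ennreal z0) = (\<Sum>n. ennreal (n_step W P n [] [] * z0 ^ n))"
    unfolding green_def gf_def using n_step_bounds(1) z0'
    by (intro arg_cong[where f = suminf] ext) (simp add: occ_eq_n_step ennreal_mult ennreal_power)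
  ultimately show thesis using that z0' by simp
qed

end

section \<open>Almost sure behaviour of block lengths and exit times\<close>

locale free_product_random_walk = free_product_walk +
  fixes M :: "'w measure" and Z :: "nat \<Rightarrow> 'w \<Rightarrow> 'a list"
  assumes chain: "markov_chain M W P [] Z"
begin

lemma prob_space_M: "prob_space M"
  using chain by (simp add: markov_chain_def)

lemma Z_in_W: "\<omega> \<in> space M \<Longrightarrow> Z n \<omega> \<in> W"
  using chain measurable_space[of "Z n" M "count_space W" \<omega>] by (simp add: markov_chain_def)

lemma Z_measurable [measurable]: "Z n \<in> measurable M (count_space UNIV)"
  using chain measurable_compose[of "Z n" M "count_space W" "\<lambda>x. x" "count_space UNIV"]
  by (simp add: markov_chain_def)

text \<open>
  Cylinders that do not constrain the times before \<open>m\<close>.  Passing from \<open>m\<close> to \<open>m + 1\<close> sums over the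
  position at time \<open>m\<close>, which is exactly the forward recursion of \<open>occ\<close>.
\<close>

lemma emeasure_cylinder:
  assumes "m \<le> n" "\<And>j. s j \<in> W"
  shows "emeasure M {\<omega> \<in> space M. \<forall>j\<in>{m..n}. Z j \<omega> = s j} =
    occ m (s m) * (\<Prod>j\<in>{m..<n}. ennreal (P (s j) (s (Suc j))))"
  using assms
proof (induction m arbitrary: s)
  case 0
  interpret prob_space M by (rule prob_space_M)
  have "measure M {\<omega> \<in> space M. \<forall>j\<le>n. Z j \<omega> = s j} =
      (if s 0 = [] then \<Prod>j<n. P (s j) (s (Suc j)) else 0)"
    using chain 0 by (simp add: markov_chain_def)
  moreover have "{\<omega> \<in> space M. \<forall>j\<in>{0..n}. Z j \<omega> = s j} = {\<omega> \<in> space M. \<forall>j\<le>n. Z j \<omega> = s j}"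
    by auto
  ultimately show ?case
    by (simp add: emeasure_eq_measure atLeast0LessThan prod_ennreal P_nonneg)
next
  case (Suc m)
  let ?A = "\<lambda>x. {\<omega> \<in> space M. \<forall>j\<in>{m..n}. Z j \<omega> = (s(m := x)) j}"
  have "{\<omega> \<in> space M. \<forall>j\<in>{Suc m..n}. Z j \<omega> = s j} = (\<Union>x\<in>W. ?A x)"
  proof (rule set_eqI)
    fix \<omega>
    have "{m..n} = insert m {Suc m..n}" using Suc.prems(1) by auto
    then show "\<omega> \<in> {\<omega> \<in> space M. \<forall>j\<in>{Suc m..n}. Z j \<omega> = s j} \<longleftrightarrow> \<omega> \<in> (\<Union>x\<in>W. ?A x)"
      using Z_in_W[of \<omega> m] by auto
  qed
  also have "emeasure M (\<Union>x\<in>W. ?A x) = (\<integral>\<^sup>+x. emeasure M (?A x) \<partial>count_space W)"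
  proof (rule emeasure_UN_countable)
    show "disjoint_family_on ?A W"
      unfolding disjoint_family_on_def
    proof (intro ballI impI)
      fix x y :: "'a list" assume "x \<noteq> y"
      have "x = y" if "\<omega> \<in> ?A x" "\<omega> \<in> ?A y" for \<omega>
      proof -
        have "m \<in> {m..n}" using Suc.prems(1) by simp
        with that have "Z m \<omega> = x" "Z m \<omega> = y" by fastforce+
        then show ?thesis by simp
      qed
      with \<open>x \<noteq> y\<close> show "?A x \<inter> ?A y = {}" by blast
    qed
  qed (auto simp: countable_W)
  also have "\<dots> = (\<integral>\<^sup>+x. occ m x * P x (s (Suc m)) * (\<Prod>j\<in>{Suc m..<n}. ennreal (P (s j) (s (Suc j)))) \<partial>count_space W)"
  proof (rule nn_integral_cong)
    fix x assume "x \<in> space (count_space W)"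
    then have x: "x \<in> W" by simp
    have "emeasure M (?A x) = occ m x * (\<Prod>j\<in>{m..<n}. ennreal (P ((s(m := x)) j) ((s(m := x)) (Suc j))))"
      using Suc.IH[of "s(m := x)"] Suc.prems x by simp
    also have "(\<Prod>j\<in>{m..<n}. ennreal (P ((s(m := x)) j) ((s(m := x)) (Suc j)))) =
        P x (s (Suc m)) * (\<Prod>j\<in>{Suc m..<n}. ennreal (P (s j) (s (Suc j))))"
      using Suc.prems(1) by (subst prod.atLeast_Suc_lessThan) (auto intro!: arg_cong2[where f = "(*)"] prod.cong)
    finally show "emeasure M (?A x) = occ m x * P x (s (Suc m)) *
        (\<Prod>j\<in>{Suc m..<n}. ennreal (P (s j) (s (Suc j))))"
      by (simp add: mult.assoc)
  qed
  also have "\<dots> = occ (Suc m) (s (Suc m)) * (\<Prod>j\<in>{Suc m..<n}. ennreal (P (s j) (s (Suc j))))"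
    by (simp add: nn_integral_multc)
  finally show ?case .
qed

lemma emeasure_Z: "x \<in> W \<Longrightarrow> emeasure M {\<omega> \<in> space M. Z n \<omega> = x} = occ n x"
  using emeasure_cylinder[of n n "\<lambda>_. x"] by simp

lemma emeasure_step:
  assumes "x \<in> W" "y \<in> W"
  shows "emeasure M {\<omega> \<in> space M. Z n \<omega> = x \<and> Z (Suc n) \<omega> = y} = occ n x * P x y"
proof -
  have "{n..Suc n} = {n, Suc n}" by auto
  then have "{\<omega> \<in> space M. Z n \<omega> = x \<and> Z (Suc n) \<omega> = y} =
      {\<omega> \<in> space M. \<forall>j\<in>{n..Suc n}. Z j \<omega> = (if j = n then x else y)}"
    by auto
  then show ?thesis
    using emeasure_cylinder[of n "Suc n" "\<lambda>j. if j = n then x else y"] assms by simp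
qed

lemma nn_integral_Z:
  "(\<integral>\<^sup>+\<omega>. f (Z n \<omega>) \<partial>M) = (\<integral>\<^sup>+x. occ n x * f x \<partial>count_space W)"
  for f :: "'a list \<Rightarrow> ennreal"
proof -
  have "(\<integral>\<^sup>+\<omega>. f (Z n \<omega>) \<partial>M) =
      (\<integral>\<^sup>+\<omega>. \<integral>\<^sup>+x. f x * indicator {\<omega> \<in> space M. Z n \<omega> = x} \<omega> \<partial>count_space W \<partial>M)"
  proof (rule nn_integral_cong)
    fix \<omega> assume \<omega>: "\<omega> \<in> space M"
    have "(\<integral>\<^sup>+x. f x * indicator {\<omega> \<in> space M. Z n \<omega> = x} \<omega> \<partial>count_space W) =
        (\<integral>\<^sup>+x. f (Z n \<omega>) * indicator {Z n \<omega>} x \<partial>count_space W)"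
      using \<omega> by (intro nn_integral_cong) (auto simp: indicator_def)
    then show "f (Z n \<omega>) = (\<integral>\<^sup>+x. f x * indicator {\<omega> \<in> space M. Z n \<omega> = x} \<omega> \<partial>count_space W)"
      using Z_in_W[OF \<omega>] by (simp add: nn_integral_cmult_indicator)
  qed
  also have "\<dots> = (\<integral>\<^sup>+x. \<integral>\<^sup>+\<omega>. f x * indicator {\<omega> \<in> space M. Z n \<omega> = x} \<omega> \<partial>M \<partial>count_space W)"
    by (rule nn_integral_count_space_nn_integral) (auto simp: countable_W)
  also have "\<dots> = (\<integral>\<^sup>+x. occ n x * f x \<partial>count_space W)"
    by (intro nn_integral_cong) (simp add: nn_integral_cmult_indicator emeasure_Z mult.commute)
  finally show ?thesis .
qed

lemma AE_starts_at_Nil: "AE \<omega> in M. Z 0 \<omega> = []"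
proof -
  have "AE \<omega> in M. \<forall>x\<in>W. x \<noteq> [] \<longrightarrow> Z 0 \<omega> \<noteq> x"
  proof (intro AE_ball_countable[THEN iffD2] ballI countable_W)
    fix x assume x: "x \<in> W"
    show "AE \<omega> in M. x \<noteq> [] \<longrightarrow> Z 0 \<omega> \<noteq> x"
    proof (cases "x = []")
      case False
      then have "emeasure M {\<omega> \<in> space M. Z 0 \<omega> = x} = 0" using emeasure_Z[OF x, of 0] by simp
      then show ?thesis by (intro AE_I[where N = "{\<omega> \<in> space M. Z 0 \<omega> = x}"]) auto
    qed simp
  qed
  then show ?thesis
    by (rule AE_mp) (use Z_in_W[of _ 0] in \<open>auto intro!: AE_I2\<close>)
qed

lemma AE_possible_steps: "AE \<omega> in M. \<forall>n. P (Z n \<omega>) (Z (Suc n) \<omega>) \<noteq> 0"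
proof (subst AE_all_countable, intro allI)
  fix n
  have "AE \<omega> in M. \<forall>x\<in>W. \<forall>y\<in>W. P x y = 0 \<longrightarrow> \<not> (Z n \<omega> = x \<and> Z (Suc n) \<omega> = y)"
  proof (intro AE_ball_countable[THEN iffD2] ballI countable_W)
    fix x y assume xy: "x \<in> W" "y \<in> W"
    show "AE \<omega> in M. P x y = 0 \<longrightarrow> \<not> (Z n \<omega> = x \<and> Z (Suc n) \<omega> = y)"
    proof (cases "P x y = 0")
      case True
      then have "emeasure M {\<omega> \<in> space M. Z n \<omega> = x \<and> Z (Suc n) \<omega> = y} = 0"
        using emeasure_step[OF xy, of n] by simp
      then show ?thesis
        by (intro AE_I[where N = "{\<omega> \<in> space M. Z n \<omega> = x \<and> Z (Suc n) \<omega> = y}"]) auto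
    qed simp
  qed
  then show "AE \<omega> in M. P (Z n \<omega>) (Z (Suc n) \<omega>) \<noteq> 0"
  proof (rule AE_mp, intro AE_I2 impI)
    fix \<omega> assume \<omega>: "\<omega> \<in> space M"
      and "\<forall>x\<in>W. \<forall>y\<in>W. P x y = 0 \<longrightarrow> \<not> (Z n \<omega> = x \<and> Z (Suc n) \<omega> = y)"
    then show "P (Z n \<omega>) (Z (Suc n) \<omega>) \<noteq> 0" using Z_in_W[OF \<omega>] by blast
  qed
qed

text \<open>
  A series with finite expectation converges almost surely, so its terms are eventually below \<open>1\<close>.
\<close>

lemma AE_moment_small:
  assumes "moment_gf s c \<noteq> \<top>"
  shows "AE \<omega> in M. eventually (\<lambda>n. s * (real n - c * real (length (Z n \<omega>))) < 0) sequentially"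
proof -
  define f where "f n \<omega> = exp (s * (real n - c * real (length (Z n \<omega>))))" for n \<omega>
  have f: "ennreal (f n \<omega>) = ennreal (exp (- s * c)) ^ length (Z n \<omega>) * ennreal (exp s) ^ n" for n \<omega>
  proof -
    have "f n \<omega> = exp (- s * c) ^ length (Z n \<omega>) * exp s ^ n"
      by (simp add: f_def exp_of_nat_mult[symmetric] exp_add[symmetric] algebra_simps)
    then show ?thesis by (simp add: ennreal_mult ennreal_power)
  qed
  have meas: "(\<lambda>\<omega>. g (Z n \<omega>)) \<in> borel_measurable M" for g :: "'a list \<Rightarrow> ennreal" and n
    by (rule measurable_compose[OF Z_measurable]) simp
  have meas_f [measurable]: "(\<lambda>\<omega>. ennreal (f n \<omega>)) \<in> borel_measurable M" for n
    unfolding f by (rule meas[of "\<lambda>x. ennreal (exp (- s * c)) ^ length x * ennreal (exp s) ^ n"])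
  have "(\<integral>\<^sup>+\<omega>. (\<Sum>n. ennreal (f n \<omega>)) \<partial>M) = (\<Sum>n. \<integral>\<^sup>+\<omega>. ennreal (f n \<omega>) \<partial>M)"
    by (rule nn_integral_suminf) (rule meas_f)
  also have "\<dots> = (\<Sum>n. (\<integral>\<^sup>+\<omega>. ennreal (exp (- s * c)) ^ length (Z n \<omega>) \<partial>M) * ennreal (exp s) ^ n)"
    unfolding f by (intro arg_cong[where f = suminf] ext nn_integral_multc
        meas[of "\<lambda>x. ennreal (exp (- s * c)) ^ length x"])
  also have "\<dots> \<noteq> \<top>"
    using assms unfolding moment_gf_def gf_def nn_integral_Z[of "\<lambda>x. ennreal (exp (- s * c)) ^ length x"] .
  finally have fin: "(\<integral>\<^sup>+\<omega>. (\<Sum>n. ennreal (f n \<omega>)) \<partial>M) \<noteq> \<infinity>" by simp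
  have "(\<lambda>\<omega>. \<Sum>n. ennreal (f n \<omega>)) \<in> borel_measurable M" by measurable
  from nn_integral_noteq_infinite[OF this fin]
  have "AE \<omega> in M. (\<Sum>n. ennreal (f n \<omega>)) \<noteq> \<infinity>" .
  then show ?thesis
  proof (rule AE_mp, intro AE_I2 impI)
    fix \<omega> assume "(\<Sum>n. ennreal (f n \<omega>)) \<noteq> \<infinity>"
    then have "summable (\<lambda>n. f n \<omega>)"
      by (intro summable_suminf_not_top) (auto simp: f_def)
    then have "eventually (\<lambda>n. f n \<omega> < 1) sequentially"
      using summable_LIMSEQ_zero order_tendstoD(2) zero_less_one by blast
    then show "eventually (\<lambda>n. s * (real n - c * real (length (Z n \<omega>))) < 0) sequentially"
      by eventually_elim (simp add: f_def)
  qed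
qed

text \<open>
  Countably many values of \<open>c\<close> that approach \<open>\<Lambda>\<close> from both sides suffice.
\<close>

lemma AE_block_length_limit:
  assumes \<Lambda>: "0 < \<Lambda>"
    and upper: "\<forall>c>\<Lambda>. \<exists>s>0. moment_gf s c \<noteq> \<top>"
    and lower: "\<forall>c<\<Lambda>. \<exists>s<0. moment_gf s c \<noteq> \<top>"
  shows "AE \<omega> in M. (\<lambda>n. real (length (Z n \<omega>)) / real n) \<longlonglongrightarrow> 1 / \<Lambda>"
proof -
  have up: "AE \<omega> in M. eventually (\<lambda>n. real n < c * real (length (Z n \<omega>))) sequentially" if "\<Lambda> < c" for c
  proof -
    from upper that obtain s where "s > 0" "moment_gf s c \<noteq> \<top>" by blast
    with AE_moment_small[of s c] show ?thesis by (simp add: mult_less_0_iff)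
  qed
  have lo: "AE \<omega> in M. eventually (\<lambda>n. c * real (length (Z n \<omega>)) < real n) sequentially" if "c < \<Lambda>" for c
  proof -
    from lower that obtain s where "s < 0" "moment_gf s c \<noteq> \<top>" by blast
    with AE_moment_small[of s c] show ?thesis by (simp add: mult_less_0_iff)
  qed
  define \<delta> where "\<delta> m = inverse (real (Suc m))" for m
  have \<delta>: "0 < \<delta> m" for m by (simp add: \<delta>_def)
  have "AE \<omega> in M. \<forall>m. eventually (\<lambda>n. real n < (\<Lambda> + \<delta> m) * real (length (Z n \<omega>))) sequentially \<and>
      eventually (\<lambda>n. (\<Lambda> - \<delta> m) * real (length (Z n \<omega>)) < real n) sequentially"
    using up[of "\<Lambda> + \<delta> _"] lo[of "\<Lambda> - \<delta> _"] \<delta> by (subst AE_all_countable) (auto intro: AE_conjI)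
  then show ?thesis
  proof (rule AE_mp, intro AE_I2 impI)
    fix \<omega>
    let ?l = "\<lambda>n. real (length (Z n \<omega>))"
    assume *: "\<forall>m. eventually (\<lambda>n. real n < (\<Lambda> + \<delta> m) * ?l n) sequentially \<and>
      eventually (\<lambda>n. (\<Lambda> - \<delta> m) * ?l n < real n) sequentially"
    have "(\<lambda>n. real n / ?l n) \<longlonglongrightarrow> \<Lambda>"
    proof (rule tendstoI)
      fix e :: real assume "e > 0"
      then obtain m where m: "\<delta> m < e" unfolding \<delta>_def using reals_Archimedean by blast
      from * have "eventually (\<lambda>n. real n < (\<Lambda> + \<delta> m) * ?l n) sequentially"
        "eventually (\<lambda>n. (\<Lambda> - \<delta> m) * ?l n < real n) sequentially" by blast+
      then show "eventually (\<lambda>n. dist (real n / ?l n) \<Lambda> < e) sequentially"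
      proof eventually_elim
        case (elim n)
        have "?l n \<noteq> 0" using elim(1) by auto
        then have "?l n > 0" by simp
        with elim have "real n / ?l n < \<Lambda> + \<delta> m" "\<Lambda> - \<delta> m < real n / ?l n"
          by (simp_all add: field_simps)
        with m show ?case by (simp add: dist_real_def abs_less_iff)
      qed
    qed
    from tendsto_inverse[OF this] \<Lambda> show "(\<lambda>n. ?l n / real n) \<longlonglongrightarrow> 1 / \<Lambda>"
      by (simp add: inverse_eq_divide)
  qed
qed

text \<open>
  Both words arise from a common stem by appending at most one letter, so only a stem with fewer
  than \<open>k\<close> letters allows the first \<open>k\<close> letters to change.
\<close>

lemma step_take:
  assumes "P x y \<noteq> 0"
  shows "take k x = take k y \<or> length x \<le> k \<and> length y \<le> k" and "length y \<le> Suc (length x)"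
proof -
  obtain i where i: "stem V i x = stem V i y" using P_pos_stem[OF assms] by blast
  show "length y \<le> Suc (length x)"
    using stem_take(1)[of y V i] stem_take(2)[of V i x] i by simp
  show "take k x = take k y \<or> length x \<le> k \<and> length y \<le> k"
  proof (cases "k \<le> length (stem V i x)")
    case True
    then show ?thesis using stem_take(3)[of k V i x] stem_take(3)[of k V i y] i by simp
  next
    case False
    then show ?thesis using stem_take(1)[of x V i] stem_take(1)[of y V i] i by simp
  qed
qed

text \<open>
  Escape to infinity makes the defining set of the exit time nonempty.  At least \<open>k\<close> blocks are
  present at the exit time, since they are the final first \<open>k\<close> blocks; and at most \<open>k\<close>, since
  the step before it changed one of the first \<open>k\<close> blocks.
\<close>

lemma exit_time_length:
  assumes start: "Z 0 \<omega> = []" and steps: "\<And>n. P (Z n \<omega>) (Z (Suc n) \<omega>) \<noteq> 0"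
    and escape: "filterlim (\<lambda>n. length (Z n \<omega>)) at_top sequentially" and k: "1 \<le> k"
  shows "length (Z (exit_time Z k \<omega>) \<omega>) = k" and "k \<le> exit_time Z k \<omega>"
proof -
  define e where "e = exit_time Z k \<omega>"
  let ?Q = "\<lambda>m. 1 \<le> m \<and> (\<forall>n\<ge>m. take k (Z n \<omega>) = take k (Z m \<omega>))"
  from escape have "eventually (\<lambda>n. Suc k \<le> length (Z n \<omega>)) sequentially"
    unfolding filterlim_at_top by blast
  then obtain N where N: "\<And>n. N \<le> n \<Longrightarrow> k < length (Z n \<omega>)"
    by (auto simp: eventually_sequentially Suc_le_eq)
  have "take k (Z (Suc N + d) \<omega>) = take k (Z (Suc N) \<omega>)" for d
  proof (induction d)
    case (Suc d)
    then show ?case using step_take(1)[OF steps, of k "Suc N + d"] N[of "Suc N + d"] by simp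
  qed simp
  then have "?Q (Suc N)" by (auto dest!: le_Suc_ex)
  then have Qe: "?Q e"
    unfolding e_def exit_time_def by (rule LeastI)
  have least: "e \<le> m" if "?Q m" for m
    unfolding e_def exit_time_def using that by (rule Least_le)
  have "length (take k (Z e \<omega>)) = k"
  proof -
    have "take k (Z (e + N) \<omega>) = take k (Z e \<omega>)" using Qe le_add1 by blast
    moreover have "length (take k (Z (e + N) \<omega>)) = k" using N[of "e + N"] by simp
    ultimately show ?thesis by simp
  qed
  then have ge: "k \<le> length (Z e \<omega>)" by simp
  have "e \<noteq> 0" using Qe by linarith
  then obtain d where d: "e = Suc d" by (cases e) blast+
  have "length (Z e \<omega>) \<le> k"
  proof (cases "d = 0")
    \<comment> \<open>Time \<open>0\<close> is not a candidate, so minimality is of no use; but \<open>Z 1\<close> has at most one block.\<close>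
    case True
    then show ?thesis using step_take(2)[OF steps, of 0] start d k by simp
  next
    case False
    have "take k (Z d \<omega>) \<noteq> take k (Z e \<omega>)"
    proof
      assume eq: "take k (Z d \<omega>) = take k (Z e \<omega>)"
      have "take k (Z n \<omega>) = take k (Z d \<omega>)" if "d \<le> n" for n
      proof (cases "n = d")
        case False
        with that d have "e \<le> n" by simp
        with Qe have "take k (Z n \<omega>) = take k (Z e \<omega>)" by blast
        with eq show ?thesis by simp
      qed simp
      moreover have "1 \<le> d" using False by simp
      ultimately have "e \<le> d" by (intro least) blast
      with d show False by simp
    qed
    then show ?thesis using step_take(1)[OF steps, of k d] d by simp
  qed
  with ge show len: "length (Z (exit_time Z k \<omega>) \<omega>) = k" by (simp add: e_def)
  have "length (Z n \<omega>) \<le> n" for n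
  proof (induction n)
    case (Suc n)
    then show ?case using step_take(2)[OF steps, of n] by simp
  qed (simp add: start)
  from this[of "exit_time Z k \<omega>"] len show "k \<le> exit_time Z k \<omega>" by simp
qed

text \<open>
  Along the exit times, \<open>length (Z n) / n\<close> is the inverse of the normalised exit time.
\<close>

lemma exit_time_limit:
  assumes start: "Z 0 \<omega> = []" and steps: "\<And>n. P (Z n \<omega>) (Z (Suc n) \<omega>) \<noteq> 0"
    and lim: "(\<lambda>n. real (length (Z n \<omega>)) / real n) \<longlonglongrightarrow> 1 / \<Lambda>" and \<Lambda>: "0 < \<Lambda>"
  shows "(\<lambda>k. real (exit_time Z k \<omega>) / real k) \<longlonglongrightarrow> \<Lambda>"
proof -
  have "filterlim (\<lambda>n. (real (length (Z n \<omega>)) / real n) * real n) at_top sequentially"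
    by (rule filterlim_tendsto_pos_mult_at_top[OF lim _ filterlim_real_sequentially]) (use \<Lambda> in simp)
  moreover have "(\<lambda>n. (real (length (Z n \<omega>)) / real n) * real n) = (\<lambda>n. real (length (Z n \<omega>)))"
    using start by (auto simp: fun_eq_iff)
  ultimately have "filterlim (\<lambda>n. real (length (Z n \<omega>))) at_top sequentially"
    by (simp only:)
  then have escape: "filterlim (\<lambda>n. length (Z n \<omega>)) at_top sequentially"
    by (simp add: filterlim_sequentially_iff_filterlim_real)
  note exit = exit_time_length[OF start steps escape]
  have "filterlim (\<lambda>k. exit_time Z k \<omega>) at_top sequentially"
    by (rule filterlim_at_top_mono[OF filterlim_ident])
       (auto intro!: eventually_mono[OF eventually_ge_at_top[of 1]] exit(2))
  from filterlim_compose[OF lim this]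
  have "(\<lambda>k. real (length (Z (exit_time Z k \<omega>) \<omega>)) / real (exit_time Z k \<omega>)) \<longlonglongrightarrow> 1 / \<Lambda>" .
  from tendsto_inverse[OF this] \<Lambda>
  have "(\<lambda>k. real (exit_time Z k \<omega>) / real (length (Z (exit_time Z k \<omega>) \<omega>))) \<longlonglongrightarrow> \<Lambda>"
    by simp
  then show ?thesis
    by (rule Lim_transform_eventually)
       (auto intro!: eventually_mono[OF eventually_ge_at_top[of 1]] simp: exit(1))
qed

end

theorem theorem3p3:
  fixes r :: nat
    and V :: "nat \<Rightarrow> 'a set"
    and rt :: "nat \<Rightarrow> 'a"
    and p :: "nat \<Rightarrow> 'a \<Rightarrow> 'a \<Rightarrow> real"
    and \<alpha> :: "nat \<Rightarrow> real"
    and M :: "'w measure"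
    and Z :: "nat \<Rightarrow> 'w \<Rightarrow> 'a list"
  assumes "r \<ge> 2"
    and "\<And>i. i \<in> {1..r} \<Longrightarrow> countable (V i)"
    and "disjoint_family_on V {1..r}"
    and "\<And>i. i \<in> {1..r} \<Longrightarrow> rt i \<in> V i"
    and "\<And>i. i \<in> {1..r} \<Longrightarrow> transition_matrix (V i) (p i)"
    and "\<And>i x. i \<in> {1..r} \<Longrightarrow> x \<in> V i \<Longrightarrow> p i x x = 0"
    and "\<And>i x. i \<in> {1..r} \<Longrightarrow> x \<in> V i \<Longrightarrow> \<exists>n\<ge>1. n_step (V i) (p i) n (rt i) x > 0"
    and "\<And>i. i \<in> {1..r} \<Longrightarrow> \<alpha> i > 0"
    and "(\<Sum>i=1..r. \<alpha> i) = 1"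
    and "conv_radius (\<lambda>n. n_step (free_product r V rt) (walk_matrix r V rt p \<alpha>) n [] []) > 1"
    and "markov_chain M (free_product r V rt) (walk_matrix r V rt p \<alpha>) [] Z"
  shows "\<exists>\<Lambda>::real. \<Lambda> > 0 \<and>
           (AE \<omega> in M. (\<lambda>k. real (exit_time Z k \<omega>) / real k) \<longlonglongrightarrow> \<Lambda>) \<and>
           (AE \<omega> in M. (\<lambda>n. real (length (Z n \<omega>)) / real n) \<longlonglongrightarrow> 1 / \<Lambda>)"
proof -
  interpret free_product_random_walk r V rt p \<alpha> M Z
    by unfold_locales (fact assms)+
  obtain z0 :: real where z0: "1 < z0" "green (ennreal z0) \<noteq> \<top>"
    by (rule green_finite_beyond_1[OF assms(10)])
  from speed_exists[OF z0] obtain \<Lambda> where \<Lambda>: "0 < \<Lambda>"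
    and upper: "\<forall>c>\<Lambda>. \<exists>s>0. moment_gf s c \<noteq> \<top>"
    and lower: "\<forall>c<\<Lambda>. \<exists>s<0. moment_gf s c \<noteq> \<top>"
    by blast
  note lim = AE_block_length_limit[OF \<Lambda> upper lower]
  have "AE \<omega> in M. (\<lambda>k. real (exit_time Z k \<omega>) / real k) \<longlonglongrightarrow> \<Lambda>"
    using lim AE_starts_at_Nil AE_possible_steps
  proof eventually_elim
    case (elim \<omega>)
    from elim(2) _ elim(1) \<Lambda> show ?case
      by (rule exit_time_limit) (rule elim(3)[rule_format])
  qed
  with \<Lambda> lim show ?thesis by blast
qed

end
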